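(* Let $q=p^m$ with $p$ prime and $m\ge 1$, let $n\ge 1$ and $1\le r\le n(q-1)$. Let $\mathcal I$ be the set of all ideals of the partially ordered set $(T(\Omega_{q,n,r}),\le)$ and let $\mathcal M$ be the set of all $\mathrm{GL}(n,\mathbb F_q)$-submodules of $H_q(r,n)$. For $I\in\mathcal I$ let $M(I)$ be the $\mathbb F_q$-linear span of $\{X^{\boldsymbol i}:\boldsymbol i\in T^{-1}(I)\}$ in $H_q(r,n)$. Then the map $$\Phi:\mathcal I\to\mathcal M,\qquad I\mapsto M(I)$$ is a (well-defined) bijection.
   Context: $\mathcal F(\mathbb F_q^n,\mathbb F_q)$ is the $\mathbb F_q$-algebra of all functions $\mathbb F_q^n\to\mathbb F_q$. Each such function is uniquely represented by a reduced polynomial ($\deg_{X_i}\le q-1$ for all $i$); its degree is the degree of that polynomial. $R_q(r,n)=\{f\in\mathcal F(\mathbb F_q^n,\mathbb F_q):\deg f\le r\}$ for $0\le r\le n(q-1)$, $R_q(-1,n)=\{0\}$, and $H_q(r,n)=R_q(r,n)/R_q(r-1,n)$. $\mathrm{GL}(n,\mathbb F_q)$ acts by $A(f)=f((X_1,\dots,X_n)A)$, which induces a $\mathrm{GL}(n,\mathbb F_q)$-module structure on $H_q(r,n)$. $\Omega_{q,n,r}=\{\boldsymbol i=(i_1,\dots,i_n)\in\{0,\dots,q-1\}^n:i_1+\cdots+i_n=r\}$ and $X^{\boldsymbol i}=X_1^{i_1}\cdots X_n^{i_n}$; the classes of $X^{\boldsymbol i}$, $\boldsymbol i\in\Omega_{q,n,r}$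 (again denoted $X^{\boldsymbol i}$), form an $\mathbb F_q$-basis of $H_q(r,n)$. For $\boldsymbol i\in\Omega_{q,n,r}$ write $i_j=\sum_{k=0}^{m-1}i_{jk}p^k$ with $0\le i_{jk}\le p-1$ (base $p$ expansion), and define $T(\boldsymbol i)=(t_0,\dots,t_{m-1})\in\mathbb N^m$ by $t_k=\sum_{l=0}^{k}\sum_{j=1}^n i_{jl}p^l$ for $0\le k\le m-1$. This gives a map $T:\Omega_{q,n,r}\to\mathbb N^m$ with image $T(\Omega_{q,n,r})$, which is partially ordered by: $(t_0,\dots,t_{m-1})\le(t_0',\dots,t_{m-1}')$ iff $t_k\le t_k'$ for all $k$. An ideal of $(T(\Omega_{q,n,r}),\le)$ is a subset $I\subset T(\Omega_{q,n,r})$ (possibly empty) such that for $\boldsymbol t,\boldsymbol t'\in T(\Omega_{q,n,r})$ with $\boldsymbol t'\le\boldsymbol t$, $\boldsymbol t\in I$ implies $\boldsymbol t'\in I$. *)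

theory Defs
  imports
    "HOL-Analysis.Cartesian_Space"
    "HOL-Library.Poly_Mapping"
    "HOL-Computational_Algebra.Polynomial"
    "HOL-Algebra.Module"
    "HOL-Algebra.AbelCoset"
    "HOL-Algebra.Algebraic_Closure_Type"
begin

text \<open>
  The field with \<open>q\<close> elements is a type \<open>'a :: {field, finite}\<close> with \<open>CARD('a) = q\<close>; vectors in
  its \<open>n\<close>-th power have type \<open>'a ^ 'n\<close> with \<open>CARD('n) = n\<close>, and functions on them have type
  \<open>'a ^ 'n \<Rightarrow> 'a\<close>. Exponent vectors have type \<open>nat ^ 'n\<close>, so that polynomials in the
  indeterminates \<open>X\<^sub>j\<close> (\<open>j :: 'n\<close>) are the elements of \<open>(nat ^ 'n) \<Rightarrow>\<^sub>0 'a\<close>, the monoid algebra of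
  the exponent vectors.
\<close>

section \<open>Degree of a function\<close>

definition monom_fun :: "nat ^ 'n \<Rightarrow> 'a ^ 'n \<Rightarrow> 'a::comm_semiring_1" where
  "monom_fun i x = (\<Prod>j\<in>UNIV. (x $ j) ^ (i $ j))"

definition poly_fun :: "((nat ^ 'n) \<Rightarrow>\<^sub>0 'a) \<Rightarrow> 'a ^ 'n \<Rightarrow> 'a::comm_semiring_1" where
  "poly_fun P x = (\<Sum>i\<in>Poly_Mapping.keys P. Poly_Mapping.lookup P i * monom_fun i x)"

definition reduced :: "((nat ^ 'n) \<Rightarrow>\<^sub>0 'a::{field,finite}) \<Rightarrow> bool" where
  "reduced P \<longleftrightarrow> (\<forall>i\<in>Poly_Mapping.keys P. \<forall>j. i $ j \<le> CARD('a) - 1)"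

definition exp_sum :: "nat ^ 'n \<Rightarrow> nat" where
  "exp_sum i = (\<Sum>j\<in>UNIV. i $ j)"

text \<open>
  The zero polynomial gets degree \<open>-1\<close>. As all other degrees are nonnegative, the functions of
  degree at most \<open>-1\<close> are then just the zero function.
\<close>

definition total_deg :: "((nat ^ 'n) \<Rightarrow>\<^sub>0 'a::zero) \<Rightarrow> int" where
  "total_deg P = (if P = 0 then -1 else int (Max (exp_sum ` Poly_Mapping.keys P)))"

definition reduced_poly :: "('a::{field,finite} ^ 'n \<Rightarrow> 'a) \<Rightarrow> ((nat ^ 'n) \<Rightarrow>\<^sub>0 'a)" where
  "reduced_poly f = (THE P. reduced P \<and> poly_fun P = f)"

text \<open>Every function is represented by exactly one reduced polynomial.\<close>

lemma finite_exponents: "finite {i :: nat ^ 'n. \<forall>j. i $ j \<le> N}"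
proof (rule finite_imageD)
  show "finite (vec_nth ` {i :: nat ^ 'n. \<forall>j. i $ j \<le> N})"
    by (rule finite_subset[of _ "PiE UNIV (\<lambda>_. {..N})"]) (auto intro!: finite_PiE)
  show "inj_on vec_nth {i :: nat ^ 'n. \<forall>j. i $ j \<le> N}"
    by (auto simp: inj_on_def vec_nth_inject)
qed

lemma poly_fun_superset:
  fixes P :: "(nat ^ 'n) \<Rightarrow>\<^sub>0 'a::comm_semiring_1"
  assumes "Poly_Mapping.keys P \<subseteq> S" "finite S"
  shows "poly_fun P x = (\<Sum>i\<in>S. Poly_Mapping.lookup P i * monom_fun i x)"
  unfolding poly_fun_def using assms
  by (intro sum.mono_neutral_left) (auto simp: in_keys_iff)

lemma indicator_univariate:
  fixes a :: "'a::{field,finite}"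
  shows "\<exists>c. \<forall>x. (\<Sum>k\<le>CARD('a) - 1. c k * x ^ k) = (if x = a then 1 else 0)"
proof -
  define L where "L = (\<Prod>b\<in>UNIV - {a}. [:- b / (a - b), 1 / (a - b):])"
  have "degree L \<le> (\<Sum>b\<in>UNIV - {a}. degree [:- b / (a - b), 1 / (a - b):])"
    unfolding L_def by (rule order.trans[OF degree_prod_sum_le]) auto
  also have "\<dots> \<le> (\<Sum>b\<in>UNIV - {a}. 1)"
    by (intro sum_mono) auto
  also have "\<dots> = CARD('a) - 1"
    by (simp add: card_Diff_singleton)
  finally have deg: "degree L \<le> CARD('a) - 1" .
  have ev: "poly L x = (if x = a then 1 else 0)" for x
  proof (cases "x = a")
    case True
    have "poly L a = (\<Prod>b\<in>UNIV - {a}. 1)"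
      unfolding L_def poly_prod by (intro prod.cong) (auto simp: divide_simps)
    then show ?thesis using True by simp
  next
    case False
    then show ?thesis unfolding L_def poly_prod
      by (auto intro!: prod_zero bexI[of _ x] simp: divide_simps)
  qed
  have "(\<Sum>k\<le>CARD('a) - 1. coeff L k * x ^ k) = poly L x" for x
    unfolding poly_altdef using deg
    by (intro sum.mono_neutral_right) (auto simp: coeff_eq_0)
  then show ?thesis using ev by (intro exI[of _ "coeff L"]) simp
qed

lemma ex1_reduced_poly:
  fixes f :: "'a::{field,finite} ^ 'n \<Rightarrow> 'a"
  shows "\<exists>!P. reduced P \<and> poly_fun P = f"
proof -
  define N where "N = CARD('a) - 1"
  define E where "E = {i :: nat ^ 'n. \<forall>j. i $ j \<le> N}"
  have finE: "finite E" unfolding E_def by (rule finite_exponents)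
  define ev where "ev c = (\<lambda>x. \<Sum>i\<in>E. c i * monom_fun i x)" for c :: "nat ^ 'n \<Rightarrow> 'a"
  define C where "C = PiE E (\<lambda>_. UNIV :: 'a set)"
  have finC: "finite C" unfolding C_def using finE by (intro finite_PiE) auto
  have bijE: "bij_betw vec_nth E (PiE UNIV (\<lambda>_. {..N}))"
    by (rule bij_betwI[of _ _ _ vec_lambda]) (auto simp: E_def vec_lambda_beta)
  have restr: "ev (restrict c E) = ev c" for c
    unfolding ev_def by (auto intro!: sum.cong)
  have surj: "\<exists>c. ev c = f" for f :: "'a ^ 'n \<Rightarrow> 'a"
  proof -
    from indicator_univariate
    have "\<exists>c. \<forall>a x :: 'a. (\<Sum>k\<le>N. c a k * x ^ k) = (if x = a then 1 else 0)"
      unfolding N_def by (intro choice) blast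
    then obtain c where c: "\<And>a x :: 'a. (\<Sum>k\<le>N. c a k * x ^ k) = (if x = a then 1 else 0)"
      by blast
    define d where "d i = (\<Sum>a\<in>UNIV. f a * (\<Prod>j\<in>UNIV. c (a $ j) (i $ j)))" for i :: "nat ^ 'n"
    have ind: "(\<Sum>i\<in>E. (\<Prod>j\<in>UNIV. c (a $ j) (i $ j)) * monom_fun i x) = (if x = a then 1 else 0)"
      for a x :: "'a ^ 'n"
    proof -
      have "(\<Sum>i\<in>E. (\<Prod>j\<in>UNIV. c (a $ j) (i $ j)) * monom_fun i x)
        = (\<Sum>i\<in>E. \<Prod>j\<in>UNIV. c (a $ j) (i $ j) * (x $ j) ^ (i $ j))"
        by (simp add: monom_fun_def prod.distrib)
      also have "\<dots> = (\<Sum>g\<in>PiE UNIV (\<lambda>_. {..N}). \<Prod>j\<in>UNIV. c (a $ j) (g j) * (x $ j) ^ (g j))"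
        using sum.reindex_bij_betw[OF bijE,
          of "\<lambda>g. \<Prod>j\<in>UNIV. c (a $ j) (g j) * (x $ j) ^ (g j)"] by simp
      also have "\<dots> = (\<Prod>j\<in>UNIV. \<Sum>k\<le>N. c (a $ j) k * (x $ j) ^ k)"
        by (rule prod_sum_PiE[symmetric]) auto
      also have "\<dots> = (\<Prod>j\<in>UNIV. if x $ j = a $ j then 1 else 0)"
        by (simp add: c)
      also have "\<dots> = (if x = a then 1 else 0)"
        by (auto simp: vec_eq_iff)
      finally show ?thesis .
    qed
    have "ev d x = f x" for x
    proof -
      have "ev d x = (\<Sum>i\<in>E. \<Sum>a\<in>UNIV. f a * ((\<Prod>j\<in>UNIV. c (a $ j) (i $ j)) * monom_fun i x))"
        by (simp add: ev_def d_def sum_distrib_right mult.assoc)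
      also have "\<dots> = (\<Sum>a\<in>UNIV. f a * (\<Sum>i\<in>E. (\<Prod>j\<in>UNIV. c (a $ j) (i $ j)) * monom_fun i x))"
        by (subst sum.swap) (simp add: sum_distrib_left)
      also have "\<dots> = f x"
        by (simp add: ind if_distrib cong: if_cong)
      finally show ?thesis .
    qed
    then show ?thesis by blast
  qed
  have img: "ev ` C = UNIV"
  proof -
    have "f \<in> ev ` C" for f
    proof -
      obtain c where "ev c = f" using surj by blast
      then have "ev (restrict c E) = f" using restr by simp
      then show ?thesis unfolding C_def by force
    qed
    then show ?thesis by blast
  qed
  have cardE: "card E = CARD('a) ^ CARD('n)"
  proof -
    have "card E = card (PiE (UNIV :: 'n set) (\<lambda>_. {..N}))" by (rule bij_betw_same_card[OF bijE])
    also have "\<dots> = (N + 1) ^ CARD('n)" by (simp add: card_PiE)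
    also have "N + 1 = CARD('a)" unfolding N_def using zero_less_card_finite[where 'a='a] by simp
    finally show ?thesis .
  qed
  have "card C = card (UNIV :: ('a ^ 'n \<Rightarrow> 'a) set)"
    unfolding C_def by (simp add: card_PiE finE cardE card_fun)
  then have inj: "inj_on ev C"
    using img finC by (intro eq_card_imp_inj_on) auto
  have ev_lookup: "poly_fun P = ev (Poly_Mapping.lookup P)" if "reduced P"
    for P :: "(nat ^ 'n) \<Rightarrow>\<^sub>0 'a"
    using that finE by (auto simp: reduced_def ev_def E_def N_def intro!: ext poly_fun_superset)
  show ?thesis
  proof (rule ex_ex1I)
    obtain c where c: "ev c = f" using surj by blast
    define P where "P = Abs_poly_mapping (\<lambda>i. if i \<in> E then c i else 0)"
    have lP: "Poly_Mapping.lookup P = (\<lambda>i. if i \<in> E then c i else 0)"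
      unfolding P_def by (rule lookup_Abs_poly_mapping) (rule finite_subset[OF _ finE], auto)
    have red: "reduced P"
      unfolding reduced_def N_def[symmetric] by (auto simp: in_keys_iff lP E_def split: if_splits)
    have "ev (Poly_Mapping.lookup P) = ev c"
      unfolding ev_def lP by (auto intro!: sum.cong)
    then show "\<exists>P. reduced P \<and> poly_fun P = f"
      using red ev_lookup[OF red] c by auto
  next
    fix P Q :: "(nat ^ 'n) \<Rightarrow>\<^sub>0 'a"
    assume P: "reduced P \<and> poly_fun P = f" and Q: "reduced Q \<and> poly_fun Q = f"
    then have "ev (restrict (Poly_Mapping.lookup P) E) = ev (restrict (Poly_Mapping.lookup Q) E)"
      using ev_lookup restr by metis
    then have eq: "restrict (Poly_Mapping.lookup P) E = restrict (Poly_Mapping.lookup Q) E"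
      using inj unfolding C_def inj_on_def by auto
    show "P = Q"
    proof (rule poly_mapping_eqI)
      fix i
      show "Poly_Mapping.lookup P i = Poly_Mapping.lookup Q i"
      proof (cases "i \<in> E")
        case True
        then show ?thesis using fun_cong[OF eq, of i] by simp
      next
        case False
        then have "i \<notin> Poly_Mapping.keys P" "i \<notin> Poly_Mapping.keys Q"
          using P Q unfolding reduced_def E_def N_def by auto
        then show ?thesis by (simp add: in_keys_iff)
      qed
    qed
  qed
qed

lemma reduced_poly_props: "reduced (reduced_poly f)" "poly_fun (reduced_poly f) = f"
  using theI'[OF ex1_reduced_poly[of f]] unfolding reduced_poly_def by auto

lemma reduced_poly_eqI: "reduced P \<Longrightarrow> poly_fun P = f \<Longrightarrow> reduced_poly f = P"
  using ex1_reduced_poly[of f] reduced_poly_props[of f] by blast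

definition fun_deg :: "('a::{field,finite} ^ 'n \<Rightarrow> 'a) \<Rightarrow> int" where
  "fun_deg f = total_deg (reduced_poly f)"

definition RM :: "int \<Rightarrow> ('a::{field,finite} ^ 'n \<Rightarrow> 'a) set" where
  "RM r = {f. fun_deg f \<le> r}"

lemma in_RM_iff:
  "f \<in> RM r \<longleftrightarrow> r \<ge> -1 \<and> (\<forall>i\<in>Poly_Mapping.keys (reduced_poly f). int (exp_sum i) \<le> r)"
proof (cases "reduced_poly f = 0")
  case True
  then show ?thesis by (simp add: RM_def fun_deg_def total_deg_def)
next
  case False
  then have ne: "Poly_Mapping.keys (reduced_poly f) \<noteq> {}" by simp
  have "f \<in> RM r \<longleftrightarrow> int (Max (exp_sum ` Poly_Mapping.keys (reduced_poly f))) \<le> r"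
    using False by (simp add: RM_def fun_deg_def total_deg_def)
  also have "\<dots> \<longleftrightarrow> (\<forall>i\<in>Poly_Mapping.keys (reduced_poly f). int (exp_sum i) \<le> r)"
  proof
    assume "int (Max (exp_sum ` Poly_Mapping.keys (reduced_poly f))) \<le> r"
    moreover have "exp_sum i \<le> Max (exp_sum ` Poly_Mapping.keys (reduced_poly f))"
      if "i \<in> Poly_Mapping.keys (reduced_poly f)" for i
      using that by (intro Max_ge) auto
    ultimately show "\<forall>i\<in>Poly_Mapping.keys (reduced_poly f). int (exp_sum i) \<le> r"
      by (meson of_nat_mono order_trans)
  next
    assume *: "\<forall>i\<in>Poly_Mapping.keys (reduced_poly f). int (exp_sum i) \<le> r"
    have "Max (exp_sum ` Poly_Mapping.keys (reduced_poly f))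
        \<in> exp_sum ` Poly_Mapping.keys (reduced_poly f)"
      using ne by (intro Max_in) auto
    then show "int (Max (exp_sum ` Poly_Mapping.keys (reduced_poly f))) \<le> r"
      using * by auto
  qed
  also have "\<dots> \<longleftrightarrow> r \<ge> -1 \<and> (\<forall>i\<in>Poly_Mapping.keys (reduced_poly f). int (exp_sum i) \<le> r)"
  proof -
    obtain i where "i \<in> Poly_Mapping.keys (reduced_poly f)" using ne by blast
    then have "r \<ge> -1" if "\<forall>i\<in>Poly_Mapping.keys (reduced_poly f). int (exp_sum i) \<le> r"
      using that by (smt (verit) of_nat_0_le_iff)
    then show ?thesis by blast
  qed
  finally show ?thesis .
qed

lemma RM_minus_one: "RM (-1) = {\<lambda>x. 0}"
proof -
  have "reduced_poly f = 0 \<longleftrightarrow> f = (\<lambda>x. 0)" for f :: "'a ^ 'n \<Rightarrow> 'a"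
  proof
    assume "reduced_poly f = 0"
    then show "f = (\<lambda>x. 0)"
      using reduced_poly_props(2)[of f] by (auto simp: poly_fun_def)
  next
    assume "f = (\<lambda>x. 0)"
    then show "reduced_poly f = 0"
      by (intro reduced_poly_eqI) (auto simp: reduced_def poly_fun_def)
  qed
  then show ?thesis
    by (auto simp: RM_def fun_deg_def total_deg_def)
qed

lemma poly_fun_add: "poly_fun (P + Q) x = poly_fun P x + poly_fun Q x"
  by (subst (1 2 3) poly_fun_superset[of _ "Poly_Mapping.keys P \<union> Poly_Mapping.keys Q"])
     (use Poly_Mapping.keys_add[of P Q] in
       \<open>auto simp: lookup_add algebra_simps sum.distrib\<close>)

lemma poly_fun_scale:
  fixes P :: "(nat ^ 'n) \<Rightarrow>\<^sub>0 'a::comm_semiring_1"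
  shows "poly_fun (Poly_Mapping.map ((*) c) P) x = c * poly_fun P x"
proof -
  have "Poly_Mapping.keys (Poly_Mapping.map ((*) c) P) \<subseteq> Poly_Mapping.keys P"
    by (auto simp: in_keys_iff Poly_Mapping.map.rep_eq when_def)
  then show ?thesis
    by (subst poly_fun_superset[of _ "Poly_Mapping.keys P"])
       (auto simp: Poly_Mapping.map.rep_eq when_def poly_fun_def sum_distrib_left mult.assoc
         in_keys_iff intro!: sum.cong)
qed

lemma RM_add: "f \<in> RM r \<Longrightarrow> g \<in> RM r \<Longrightarrow> (\<lambda>x. f x + g x) \<in> RM r"
proof -
  assume fg: "f \<in> RM r" "g \<in> RM r"
  have k: "Poly_Mapping.keys (reduced_poly f + reduced_poly g)
      \<subseteq> Poly_Mapping.keys (reduced_poly f) \<union> Poly_Mapping.keys (reduced_poly g)"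
    by (rule Poly_Mapping.keys_add)
  have "reduced_poly (\<lambda>x. f x + g x) = reduced_poly f + reduced_poly g"
    using k reduced_poly_props[of f] reduced_poly_props[of g]
    by (intro reduced_poly_eqI) (auto simp: reduced_def poly_fun_add)
  then show ?thesis using fg k by (auto simp: in_RM_iff)
qed

lemma RM_scale: "f \<in> RM r \<Longrightarrow> (\<lambda>x. c * f x) \<in> RM r"
proof -
  assume f: "f \<in> RM r"
  have k: "Poly_Mapping.keys (Poly_Mapping.map ((*) c) (reduced_poly f))
      \<subseteq> Poly_Mapping.keys (reduced_poly f)"
    by (auto simp: in_keys_iff Poly_Mapping.map.rep_eq when_def)
  have "reduced_poly (\<lambda>x. c * f x) = Poly_Mapping.map ((*) c) (reduced_poly f)"
    using k reduced_poly_props[of f]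
    by (intro reduced_poly_eqI) (auto simp: reduced_def poly_fun_scale)
  then show ?thesis using f k by (auto simp: in_RM_iff)
qed

lemma RM_zero:
  assumes "r \<ge> -1"
  shows "(\<lambda>x. 0) \<in> (RM r :: ('a::{field,finite} ^ 'n \<Rightarrow> 'a) set)"
proof -
  have "(\<lambda>x. 0) \<in> (RM (-1) :: ('a ^ 'n \<Rightarrow> 'a) set)" by (simp add: RM_minus_one)
  then show ?thesis using assms unfolding RM_def by simp
qed

lemma RM_mono: "r \<le> s \<Longrightarrow> RM r \<subseteq> RM s"
  by (auto simp: RM_def)


section \<open>The quotient \<open>R\<^sub>q(r, n) / R\<^sub>q(r - 1, n)\<close> and its submodules\<close>

definition fun_algebra :: "('a::{field,finite}, 'a ^ 'n \<Rightarrow> 'a) module" where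
  "fun_algebra = \<lparr>carrier = UNIV, monoid.mult = (\<lambda>f g x. f x * g x), one = (\<lambda>x. 1),
     ring.zero = (\<lambda>x. 0), add = (\<lambda>f g x. f x + g x), module.smult = (\<lambda>c f x. c * f x)\<rparr>"

text \<open>
  The elements of the quotient module are the cosets. Only the additive group and the scalar
  multiplication of the record are meaningful for a module; the ring multiplication and unit are
  left unspecified.
\<close>

definition quotient_module :: "('c, 'b, 'd) module_scheme \<Rightarrow> 'b set \<Rightarrow> ('c, 'b set) module" where
  "quotient_module M N = \<lparr>carrier = a_rcosets\<^bsub>M\<^esub> N, monoid.mult = undefined, one = undefined,
     ring.zero = N, add = set_add M, module.smult = (\<lambda>c C. \<Union>x\<in>C. N +>\<^bsub>M\<^esub> (c \<odot>\<^bsub>M\<^esub> x))\<rparr>"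
lemma (in module) submodule_abelian_subgroup:
  assumes "submodule N R M"
  shows "abelian_subgroup N M"
  by (rule abelian_subgroupI3[OF additive_subgroup.intro[OF submodule.axioms(1)[OF assms]]])
     (rule M.abelian_group_axioms)

lemma (in module) quotient_smult:
  assumes N: "submodule N R M" and x: "x \<in> carrier M" and c: "c \<in> carrier R"
  shows "c \<odot>\<^bsub>quotient_module M N\<^esub> (N +>\<^bsub>M\<^esub> x) = N +>\<^bsub>M\<^esub> (c \<odot>\<^bsub>M\<^esub> x)"
proof -
  note A = submodule_abelian_subgroup[OF N]
  have *: "N +>\<^bsub>M\<^esub> (c \<odot>\<^bsub>M\<^esub> y) = N +>\<^bsub>M\<^esub> (c \<odot>\<^bsub>M\<^esub> x)" if y: "y \<in> N +>\<^bsub>M\<^esub> x" for y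
  proof -
    from y obtain z where z: "z \<in> N" "y = z \<oplus>\<^bsub>M\<^esub> x" by (auto simp: a_r_coset_def')
    then have "z \<in> carrier M" "c \<odot>\<^bsub>M\<^esub> z \<in> N"
      using submoduleE(1,4)[OF N] c by blast+
    moreover from this have "c \<odot>\<^bsub>M\<^esub> y = c \<odot>\<^bsub>M\<^esub> z \<oplus>\<^bsub>M\<^esub> c \<odot>\<^bsub>M\<^esub> x"
      using x c z by (simp add: smult_r_distr)
    ultimately have "c \<odot>\<^bsub>M\<^esub> y \<in> N +>\<^bsub>M\<^esub> (c \<odot>\<^bsub>M\<^esub> x)"
      by (auto simp: a_r_coset_def')
    from abelian_subgroup.a_repr_independence'[OF A this smult_closed[OF c x]]
    show ?thesis by simp
  qed
  have "x \<in> N +>\<^bsub>M\<^esub> x" by (rule abelian_subgroup.a_rcos_self[OF A x])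
  then have "(\<Union>y\<in>N +>\<^bsub>M\<^esub> x. N +>\<^bsub>M\<^esub> (c \<odot>\<^bsub>M\<^esub> y)) = N +>\<^bsub>M\<^esub> (c \<odot>\<^bsub>M\<^esub> x)"
    by (rule UN_constant_eq) (rule ballI, rule *)
  then show ?thesis unfolding quotient_module_def by simp
qed

lemma (in module) quotient_add:
  assumes N: "submodule N R M" and x: "x \<in> carrier M" and y: "y \<in> carrier M"
  shows "(N +>\<^bsub>M\<^esub> x) \<oplus>\<^bsub>quotient_module M N\<^esub> (N +>\<^bsub>M\<^esub> y) = N +>\<^bsub>M\<^esub> (x \<oplus>\<^bsub>M\<^esub> y)"
  using abelian_subgroup.a_rcos_sum[OF submodule_abelian_subgroup[OF N] x y]
  by (simp add: quotient_module_def)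

lemma (in module) module_quotient_module:
  assumes N: "submodule N R M"
  shows "module R (quotient_module M N)"
proof -
  note A = submodule_abelian_subgroup[OF N]
  have carr: "carrier (quotient_module M N) = (\<lambda>x. N +>\<^bsub>M\<^esub> x) ` carrier M"
    by (auto simp: quotient_module_def A_RCOSETS_def')
  have "comm_group (add_monoid (quotient_module M N)) = comm_group (M A_Mod N)"
    by (simp add: quotient_module_def A_FactGroup_def' comm_group_def comm_monoid_def
        comm_monoid_axioms_def group_def group_axioms_def monoid_def Units_def)
  then have "comm_group (add_monoid (quotient_module M N))"
    using abelian_subgroup.a_factorgroup_is_comm_group[OF A] by simp
  then have ab: "abelian_group (quotient_module M N)"
    by (intro abelian_group.intro abelian_monoid.intro abelian_group_axioms.intro)
       (auto simp: comm_group_def)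
  show ?thesis
    by (rule moduleI[OF R.is_cring ab])
       (auto simp: carr quotient_smult[OF N] quotient_add[OF N] smult_l_distr smult_r_distr
          smult_assoc1)
qed

definition RM_module :: "int \<Rightarrow> ('a::{field,finite}, 'a ^ 'n \<Rightarrow> 'a) module" where
  "RM_module r = fun_algebra\<lparr>carrier := RM r\<rparr>"

definition H :: "nat \<Rightarrow> ('a::{field,finite}, ('a ^ 'n \<Rightarrow> 'a) set) module" where
  "H r = quotient_module (RM_module (int r)) (RM (int r - 1))"
lemma module_RM_module:
  assumes "r \<ge> -1"
  shows "module (ring_of_type_algebra :: 'a ring)
           (RM_module r :: ('a::{field,finite}, 'a ^ 'n \<Rightarrow> 'a) module)"
proof (rule moduleI)
  show "cring (ring_of_type_algebra :: 'a ring)" ..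
  show "abelian_group (RM_module r :: ('a, 'a ^ 'n \<Rightarrow> 'a) module)"
  proof (rule abelian_groupI)
    fix f :: "'a ^ 'n \<Rightarrow> 'a" assume "f \<in> carrier (RM_module r)"
    then show "\<exists>g\<in>carrier (RM_module r). g \<oplus>\<^bsub>RM_module r\<^esub> f = \<zero>\<^bsub>RM_module r\<^esub>"
      using RM_scale[of f r "-1"]
      by (intro bexI[of _ "\<lambda>x. - f x"]) (auto simp: RM_module_def fun_algebra_def)
  qed (use assms in \<open>auto simp: RM_module_def fun_algebra_def RM_add RM_zero algebra_simps\<close>)
qed (auto simp: RM_module_def fun_algebra_def ring_of_type_algebra_def RM_scale algebra_simps)

lemma submodule_RM:
  assumes "s \<ge> -1" "s \<le> r"
  shows "submodule (RM s :: ('a::{field,finite} ^ 'n \<Rightarrow> 'a) set)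
           (ring_of_type_algebra :: 'a ring) (RM_module r)"
proof -
  interpret module "ring_of_type_algebra :: 'a ring"
      "RM_module r :: ('a, 'a ^ 'n \<Rightarrow> 'a) module"
    using assms by (intro module_RM_module) auto
  have *: "RM_module s = (RM_module r)\<lparr>carrier := RM s\<rparr>" by (simp add: RM_module_def)
  show ?thesis
    using module_RM_module[OF assms(1), unfolded *] RM_mono[OF assms(2)]
    by (intro module_incl_imp_submodule) (auto simp: RM_module_def)
qed

lemma module_H: "module (ring_of_type_algebra :: 'a ring)
    (H r :: ('a::{field,finite}, ('a ^ 'n \<Rightarrow> 'a) set) module)"
  unfolding H_def
  by (intro module.module_quotient_module module_RM_module submodule_RM) auto

definition monom_class :: "nat \<Rightarrow> nat ^ 'n \<Rightarrow> ('a::{field,finite} ^ 'n \<Rightarrow> 'a) set" where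
  "monom_class r i = RM (int r - 1) +>\<^bsub>RM_module (int r)\<^esub> monom_fun i"

definition gl_act :: "'a::{field,finite} ^ 'n ^ 'n \<Rightarrow> ('a ^ 'n \<Rightarrow> 'a) \<Rightarrow> ('a ^ 'n \<Rightarrow> 'a)" where
  "gl_act A f = (\<lambda>x. f (x v* A))"

text \<open>
  An invertible \<open>A\<close> maps both \<open>RM r\<close> and \<open>RM (r - 1)\<close> onto themselves, so the induced action of
  \<open>A\<close> on a coset is its image under \<open>gl_act A\<close>.
\<close>

definition GL_submodules :: "nat \<Rightarrow> ('a::{field,finite} ^ 'n \<Rightarrow> 'a) set set set" where
  "GL_submodules r = {N. submodule N (ring_of_type_algebra :: 'a ring) (H r) \<and>
     (\<forall>A :: 'a ^ 'n ^ 'n. invertible A \<longrightarrow> (\<forall>C\<in>N. gl_act A ` C \<in> N))}"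


section \<open>The partially ordered set of types and the map \<open>I \<mapsto> M(I)\<close>\<close>

definition Omega :: "nat \<Rightarrow> nat \<Rightarrow> (nat ^ 'n) set" where
  "Omega q r = {i. (\<forall>j. i $ j \<in> {0..q - 1}) \<and> exp_sum i = r}"

text \<open>The \<open>l\<close>-th digit of \<open>a\<close> in base \<open>p\<close> is \<open>a div p ^ l mod p\<close>; tuples are lists of length \<open>m\<close>.\<close>

definition type_of :: "nat \<Rightarrow> nat \<Rightarrow> nat ^ 'n \<Rightarrow> nat list" where
  "type_of p m i =
     map (\<lambda>k. \<Sum>l=0..k. \<Sum>j\<in>UNIV. (i $ j div p ^ l mod p) * p ^ l) [0..<m]"

definition poset_ideals :: "nat list set \<Rightarrow> nat list set set" where
  "poset_ideals S = {I. I \<subseteq> S \<and>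
     (\<forall>t\<in>S. \<forall>t'\<in>S. list_all2 (\<le>) t' t \<longrightarrow> t \<in> I \<longrightarrow> t' \<in> I)}"

definition span_of_ideal ::
    "nat \<Rightarrow> nat \<Rightarrow> nat \<Rightarrow> nat list set \<Rightarrow> ('a::{field,finite} ^ 'n \<Rightarrow> 'a) set set" where
  "span_of_ideal p m r I =
     {(\<Oplus>\<^bsub>H r\<^esub> i\<in>{i \<in> Omega (p ^ m) r. type_of p m i \<in> I}. c i \<odot>\<^bsub>H r\<^esub> monom_class r i)
       | c :: nat ^ 'n \<Rightarrow> 'a. True}"

end

theory Submission
  imports Defs
begin

text \<open>
  A submodule of the quotient is the image of a \<open>GL\<close>-stable space \<open>W\<close> of functions between
  \<open>R\<^sub>q(r - 1, n)\<close> and \<open>R\<^sub>q(r, n)\<close>. Interpolating over the parameter of the transvections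
  \<open>X\<^sub>u \<mapsto> X\<^sub>u + a X\<^sub>v\<close> shows that \<open>W\<close> is stable under the divided-power operators
  \<open>X\<^sub>u\<^sup>i X\<^sub>v\<^sup>j \<mapsto> binom(i, k) X\<^sub>u\<^sup>i\<^sup>-\<^sup>k X\<^sub>v\<^sup>j\<^sup>+\<^sup>k\<close>. Together with the torus they separate the monomials, so
  \<open>W\<close> is spanned modulo \<open>R\<^sub>q(r - 1, n)\<close> by monomials. For \<open>k = p\<^sup>l\<close> the binomial coefficient is
  nonzero exactly when the \<open>l\<close>-th digit of \<open>i\<close> is, and moving \<open>p\<^sup>l\<close> from one exponent to another
  either keeps the type or, when a carry from \<open>k\<close> to \<open>k + 1\<close> occurs, lowers \<open>t\<^sub>k\<close> by \<open>p\<^sup>k\<^sup>+\<^sup>1\<close>; every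
  type below a given one is reached in this way. Conversely, the Frobenius endomorphism shows that a
  substitution never raises the type of a monomial.
\<close>

no_notation fps_nth (infixl "$" 75)

section \<open>Moving powers of \<open>p\<close> between exponents\<close>

definition digit :: "nat \<Rightarrow> nat \<Rightarrow> nat \<Rightarrow> nat" where
  "digit p l a = a div p ^ l mod p"

lemma sum_digits: "(\<Sum>l<k. digit p l a * p ^ l) = a mod p ^ k"
proof (induction k)
  case (Suc k)
  have "a mod p ^ Suc k = p ^ k * (a div p ^ k mod p) + a mod p ^ k"
    unfolding power_Suc2 mod_mult2_eq ..
  then show ?case using Suc by (simp add: digit_def)
qed simp

lemma digits_eqI:
  assumes "a < p ^ m" "b < p ^ m" "\<And>l. l < m \<Longrightarrow> digit p l a = digit p l b"
  shows "a = b"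
proof -
  have "a mod p ^ m = b mod p ^ m"
    unfolding sum_digits[symmetric] using assms(3) by (intro sum.cong) auto
  then show ?thesis using assms(1,2) by simp
qed

lemma digit_less: "p > 0 \<Longrightarrow> digit p l a < p"
  by (simp add: digit_def)

lemma div_add_digit:
  assumes "digit p l a + c < p" "l < k"
  shows "(a + c * p ^ l) div p ^ k = a div p ^ k"
proof -
  have p: "p > 0" using assms by auto
  obtain d where k: "k = Suc (l + d)" using assms(2) less_iff_Suc_add by auto
  have pk: "p ^ k = p ^ l * (p * p ^ d)" by (simp add: k power_add)
  have "(a div p ^ l + c) div p = a div p ^ l div p"
    using assms(1) p by (subst div_add1_eq) (simp add: digit_def)
  then show ?thesis using p by (simp add: pk div_mult2_eq add.commute)
qed

lemma digit_add:
  assumes "digit p l a + c < p"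
  shows "digit p k (a + c * p ^ l) = digit p k a + (if k = l then c else 0)"
proof -
  have p: "p > 0" using assms by auto
  consider "k < l" | "k = l" | "l < k" by linarith
  then show ?thesis
  proof cases
    case 1
    then obtain d where l: "l = Suc (k + d)" using less_iff_Suc_add by auto
    have "a + c * p ^ l = a + (c * p ^ d * p) * p ^ k" by (simp add: l power_add)
    then have "(a + c * p ^ l) div p ^ k = a div p ^ k + c * p ^ d * p"
      using p by (simp only: div_mult_self3) simp
    then show ?thesis using 1 by (simp add: digit_def)
  next
    case 2
    have "(a div p ^ l + c) mod p = a div p ^ l mod p + c"
      using assms unfolding digit_def by (metis mod_add_left_eq mod_less)
    then show ?thesis using 2 p by (simp add: digit_def add.commute)
  next
    case 3
    then show ?thesis using div_add_digit[OF assms 3] by (simp add: digit_def)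
  qed
qed

text \<open>Reduces to \<open>digit_add\<close>: the difference \<open>b\<close> has enough room at
  digit \<open>l\<close> for \<open>c * p ^ l\<close> to be added back without a carry.\<close>

lemma digit_diff:
  assumes "c \<le> digit p l a" "p > 0"
  shows "c * p ^ l \<le> a"
    and "digit p k (a - c * p ^ l) = digit p k a - (if k = l then c else 0)"
proof -
  have "c \<le> a div p ^ l" using assms(1) unfolding digit_def by (meson mod_less_eq_dividend order_trans)
  then have "c * p ^ l \<le> a div p ^ l * p ^ l" by simp
  also have "\<dots> \<le> a" by simp
  finally show le: "c * p ^ l \<le> a" .
  define b where "b = a - c * p ^ l"
  have a: "a = b + c * p ^ l" using le by (simp add: b_def)
  have "a div p ^ l = b div p ^ l + c" using assms(2) by (simp add: a)
  then have "b div p ^ l = p * (a div p ^ l div p) + (digit p l a - c)"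
    using assms(1) mult_div_mod_eq[of p "a div p ^ l"] by (simp add: digit_def)
  then have "digit p l b = (digit p l a - c) mod p"
    by (simp add: digit_def)
  also have "\<dots> = digit p l a - c"
    using digit_less[OF assms(2), of l a] by simp
  finally have "digit p l b = digit p l a - c" .
  then have "digit p l b + c < p" using assms digit_less[of p l a] by simp
  from digit_add[OF this, of k] show "digit p k (a - c * p ^ l) = digit p k a - (if k = l then c else 0)"
    by (simp add: a[symmetric] b_def[symmetric])
qed

lemma add_digit_less_power:
  assumes "digit p l a + c < p" "l < m" "a < p ^ m"
  shows "a + c * p ^ l < p ^ m"
proof -
  have "(a + c * p ^ l) div p ^ m = 0" using div_add_digit[OF assms(1,2)] assms(3) by simp
  moreover have "p > 0" using assms by auto
  ultimately show ?thesis by (simp add: div_eq_0_iff)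
qed

section \<open>Moves, digit sums and types\<close>

lemma sum_eq_exchange:
  fixes f g :: "'n::finite \<Rightarrow> nat"
  assumes "sum f UNIV = sum g UNIV" "f \<noteq> g"
  obtains u v where "g u < f u" "f v < g v"
proof -
  have "\<exists>u. g u < f u" if eq: "sum f UNIV = sum g UNIV" and ne: "f \<noteq> g" for f g :: "'n \<Rightarrow> nat"
  proof (rule ccontr)
    assume *: "\<not> ?thesis"
    then have "\<And>x. f x \<le> g x" by (simp add: not_less)
    moreover obtain x where "f x \<noteq> g x" using ne by (auto simp: fun_eq_iff)
    ultimately have "sum f UNIV < sum g UNIV"
      by (intro sum_strict_mono_ex1) (auto simp: order_less_le)
    then show False using eq by simp
  qed
  from this[OF assms] this[OF assms(1)[symmetric]] assms(2) that show thesis by metis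
qed

text \<open>Replaces a factor \<open>X_u ^ k\<close> by \<open>X_v ^ k\<close>; as subtraction is
  truncated, this reading is valid only for \<open>k \<le> s $ u\<close> and
  \<open>u \<noteq> v\<close>.\<close>

definition shift :: "'n \<Rightarrow> 'n \<Rightarrow> nat \<Rightarrow> nat ^ 'n \<Rightarrow> nat ^ 'n" where
  "shift u v k s = (\<chi> j. if j = u then s $ u - k else if j = v then s $ v + k else s $ j)"

definition digit_sum :: "nat \<Rightarrow> nat \<Rightarrow> nat ^ 'n \<Rightarrow> nat" where
  "digit_sum p l i = (\<Sum>j\<in>UNIV. digit p l (i $ j))"

lemma digit_sum_le: "p > 0 \<Longrightarrow> digit_sum p l (i :: nat ^ 'n) \<le> CARD('n) * (p - 1)"
  unfolding digit_sum_def using sum_bounded_above[of UNIV "\<lambda>j. digit p l (i $ j)" "p - 1"]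
    digit_less[of p l] by (simp add: less_Suc_eq_le[symmetric])

definition type_entry :: "nat \<Rightarrow> nat ^ 'n \<Rightarrow> nat \<Rightarrow> nat" where
  "type_entry p i k = (\<Sum>l\<le>k. digit_sum p l i * p ^ l)"

text \<open>Collecting the digits of each exponent separately turns \<open>t_k\<close> into a sum of
  residues, which gives access to congruences and subadditivity.\<close>

lemma type_entry_mod: "type_entry p i k = (\<Sum>j\<in>UNIV. i $ j mod p ^ Suc k)"
proof -
  have "type_entry p i k = (\<Sum>j\<in>UNIV. \<Sum>l\<le>k. digit p l (i $ j) * p ^ l)"
    unfolding type_entry_def digit_sum_def sum_distrib_right by (rule sum.swap)
  then show ?thesis by (simp only: sum_digits[symmetric] lessThan_Suc_atMost)
qed

lemma type_of_entries: "type_of p m i = map (type_entry p i) [0..<m]"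
  by (simp add: type_of_def type_entry_def digit_sum_def digit_def sum_distrib_right atLeast0AtMost)

lemma list_all2_map_upt:
  "list_all2 R (map f [0..<m]) (map g [0..<m]) \<longleftrightarrow> (\<forall>k<m. R (f k) (g k))"
  by (auto simp: list_all2_conv_all_nth)

lemma type_entry_Suc: "type_entry p i (Suc k) = type_entry p i k + digit_sum p (Suc k) i * p ^ Suc k"
  by (simp add: type_entry_def)

text \<open>Exponents below \<open>p ^ m\<close> are their own residues. Hence all types occurring
  in one degree share their last entry.\<close>

lemma type_entry_last:
  assumes "\<And>j. i $ j < p ^ m" "m > 0"
  shows "type_entry p i (m - 1) = exp_sum i"
  using assms by (simp add: type_entry_mod exp_sum_def del: power_Suc)

text \<open>Both entries are congruent to the common exponent sum modulo \<open>p ^ Suc k\<close>,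
  so they cannot differ by less. One carry lowers \<open>t_k\<close> by exactly this amount.\<close>

lemma type_entry_diff_dvd:
  assumes "\<And>j. i $ j < p ^ m" "\<And>j. i' $ j < p ^ m" "exp_sum i = exp_sum i'" "m > 0" "k < m"
    "type_entry p i' k < type_entry p i k"
  shows "type_entry p i' k + p ^ Suc k \<le> type_entry p i k"
proof -
  have "type_entry p i k mod p ^ Suc k = type_entry p i' k mod p ^ Suc k"
    using assms(3) by (simp add: type_entry_mod mod_sum_eq exp_sum_def del: power_Suc)
  then have "p ^ Suc k dvd type_entry p i k - type_entry p i' k"
    using assms(6) by (subst mod_eq_dvd_iff_nat[symmetric]) auto
  then have "p ^ Suc k \<le> type_entry p i k - type_entry p i' k"
    using assms(6) by (intro dvd_imp_le) auto
  then show ?thesis using assms(6) by linarith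
qed

section \<open>Sets of exponents closed under moves\<close>

text \<open>Abstracts the monomials of an invariant subspace. The digit condition at
  \<open>u\<close> is what makes a binomial coefficient nonzero; at \<open>v\<close> carries are
  allowed as long as the exponent stays below \<open>p ^ m\<close>.\<close>

locale move_closed =
  fixes p m :: nat and J :: "(nat ^ 'n) set"
  assumes p: "p > 1"
    and bound: "i \<in> J \<Longrightarrow> i $ j < p ^ m"
    and move: "\<lbrakk>i \<in> J; u \<noteq> v; l < m; digit p l (i $ u) > 0; i $ v + p ^ l < p ^ m\<rbrakk>
      \<Longrightarrow> shift u v (p ^ l) i \<in> J"
begin

lemma move_digit:
  assumes "i \<in> J" "l < m" "u \<noteq> v" "digit p l (i $ u) > 0" "digit p l (i $ v) < p - 1"
  obtains i1 where "i1 \<in> J"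
    "\<And>k j. digit p k (i1 $ j) =
      (if k = l \<and> j = u then digit p k (i $ j) - 1
       else if k = l \<and> j = v then digit p k (i $ j) + 1 else digit p k (i $ j))"
proof
  have "digit p l (i $ v) + 1 < p" using assms by simp
  note add = digit_add[OF this] add_digit_less_power[OF this assms(2) bound[OF assms(1)]]
  show "shift u v (p ^ l) i \<in> J" using move[OF assms(1,3,2,4)] add(2) by simp
  show "digit p k (shift u v (p ^ l) i $ j) =
      (if k = l \<and> j = u then digit p k (i $ j) - 1
       else if k = l \<and> j = v then digit p k (i $ j) + 1 else digit p k (i $ j))" for k j
    using add(1)[of k] digit_diff(2)[of 1 p l "i $ u" k] assms p by (auto simp: shift_def)
qed

lemma digit_sum_change:
  fixes i i1 :: "nat ^ 'n"
  assumes "u \<noteq> v" "digit p l (i $ u) > 0"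
    "\<And>k j. digit p k (i1 $ j) =
      (if k = l \<and> j = u then digit p k (i $ j) - 1
       else if k = l \<and> j = v then digit p k (i $ j) + 1 else digit p k (i $ j))"
  shows "digit_sum p k i1 = digit_sum p k i"
proof (cases "k = l")
  case True
  have *: "digit_sum p l x = digit p l (x $ u) + (digit p l (x $ v) + (\<Sum>j\<in>UNIV - {u} - {v}. digit p l (x $ j)))"
    for x :: "nat ^ 'n"
    unfolding digit_sum_def using assms(1)
    by (subst sum.remove[of _ u], simp, simp, subst sum.remove[of _ v], simp_all)
  have "(\<Sum>j\<in>UNIV - {u} - {v}. digit p l (i1 $ j)) = (\<Sum>j\<in>UNIV - {u} - {v}. digit p l (i $ j))"
    by (intro sum.cong) (auto simp: assms(3))
  then show ?thesis using assms(1,2) True by (simp add: * assms(3)[of l u] assms(3)[of l v])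
qed (auto simp: digit_sum_def assms(3) intro!: sum.cong)

text \<open>Carry-free moves connect all vectors with the same digit sums: where \<open>i\<close>
  and \<open>i'\<close> differ, a unit goes from a coordinate with surplus to one with deficit. The
  induction measure is the total surplus.\<close>

lemma same_digit_sums:
  assumes "i \<in> J" "\<And>j. i' $ j < p ^ m" "\<And>l. l < m \<Longrightarrow> digit_sum p l i = digit_sum p l i'"
  shows "i' \<in> J"
  using assms(1,3)
proof (induction "\<Sum>l<m. \<Sum>j\<in>UNIV. digit p l (i $ j) - digit p l (i' $ j)"
    arbitrary: i rule: less_induct)
  case less
  show ?case
  proof (cases "i = i'")
    case False
    then obtain j where "i $ j \<noteq> i' $ j" by (auto simp: vec_eq_iff)
    then obtain l where l: "l < m" "digit p l (i $ j) \<noteq> digit p l (i' $ j)"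
      using digits_eqI[OF bound[OF less(2)] assms(2)] by metis
    have "(\<lambda>j. digit p l (i $ j)) \<noteq> (\<lambda>j. digit p l (i' $ j))" using l by metis
    then obtain u v where uv: "digit p l (i' $ u) < digit p l (i $ u)"
        "digit p l (i $ v) < digit p l (i' $ v)"
      using sum_eq_exchange less(3)[OF l(1)] unfolding digit_sum_def by blast
    have ne: "u \<noteq> v" using uv by auto
    have pos: "digit p l (i $ u) > 0" using uv by simp
    have "digit p l (i $ v) < p - 1" using uv digit_less[of p l "i' $ v"] p by linarith
    from move_digit[OF less(2) l(1) ne pos this] obtain i1 where i1: "i1 \<in> J"
      and d: "\<And>k j. digit p k (i1 $ j) =
      (if k = l \<and> j = u then digit p k (i $ j) - 1
       else if k = l \<and> j = v then digit p k (i $ j) + 1 else digit p k (i $ j))" by blast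
    show ?thesis
    proof (rule less(1)[OF _ i1])
      \<comment> \<open>At \<open>v\<close> both truncated differences vanish, as the digit of
        \<open>i\<close> lies strictly below that of \<open>i'\<close> there.\<close>
      have le: "digit p k (i1 $ j) - digit p k (i' $ j) \<le> digit p k (i $ j) - digit p k (i' $ j)"
        for k j using uv by (auto simp: d)
      have "(\<Sum>j\<in>UNIV. digit p l (i1 $ j) - digit p l (i' $ j))
          < (\<Sum>j\<in>UNIV. digit p l (i $ j) - digit p l (i' $ j))"
        using le uv ne by (intro sum_strict_mono_ex1) (simp_all, intro exI[of _ u], simp add: d)
      then show "(\<Sum>l<m. \<Sum>j\<in>UNIV. digit p l (i1 $ j) - digit p l (i' $ j))
          < (\<Sum>l<m. \<Sum>j\<in>UNIV. digit p l (i $ j) - digit p l (i' $ j))"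
        using l le by (intro sum_strict_mono_ex1) (auto intro!: sum_mono)
      show "\<And>l. l < m \<Longrightarrow> digit_sum p l i1 = digit_sum p l i'"
        using less(3) digit_sum_change[OF ne pos d] by simp
    qed
  qed (use less in simp)
qed

text \<open>Carry-free moves first fill digit \<open>k\<close> of some \<open>v\<close> up to
  \<open>p - 1\<close>; one more unit overflows it. This trades \<open>p\<close> units at position
  \<open>k\<close> for one at \<open>Suc k\<close>, where \<open>v\<close> was chosen to have
  room.\<close>

lemma carry_step:
  assumes "i \<in> J" "Suc k < m" "digit_sum p k i \<ge> p" "digit_sum p (Suc k) i < CARD('n) * (p - 1)"
  obtains i1 where "i1 \<in> J" "\<And>l. digit_sum p l i1 =
    (if l = k then digit_sum p k i - p else if l = Suc k then digit_sum p l i + 1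
     else digit_sum p l i)"
proof -
  have "\<exists>v. digit p (Suc k) (i $ v) < p - 1"
  proof (rule ccontr)
    assume "\<not> ?thesis"
    then have "(\<Sum>j\<in>(UNIV::'n set). p - 1) \<le> digit_sum p (Suc k) i"
      unfolding digit_sum_def by (intro sum_mono) (auto simp: not_less)
    then show False using assms(4) by simp
  qed
  then obtain v where v: "digit p (Suc k) (i $ v) < p - 1" by blast
  have "\<exists>i1\<in>J. \<forall>l. digit_sum p l i1 =
    (if l = k then digit_sum p k i - p else if l = Suc k then digit_sum p l i + 1
     else digit_sum p l i)"
    using assms(1,3) v
  proof (induction "p - 1 - digit p k (i $ v)" arbitrary: i rule: less_induct)
    case less
    have split: "digit_sum p l x = digit p l (x $ v) + (\<Sum>j\<in>UNIV - {v}. digit p l (x $ j))"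
      for l and x :: "nat ^ 'n"
      unfolding digit_sum_def by (subst sum.remove[of _ v]) simp_all
    have "(\<Sum>j\<in>UNIV - {v}. digit p k (i $ j)) > 0"
      using less(3) split[of k i] digit_less[of p k "i $ v"] p by linarith
    then obtain u where u: "u \<noteq> v" "digit p k (i $ u) > 0"
      by (metis (no_types, lifting) DiffD2 gr0I less_numeral_extra(3) singletonI sum.neutral)
    show ?case
    proof (cases "digit p k (i $ v) < p - 1")
      case True
      from move_digit[OF less(2) _ u True] assms(2) obtain i1 where i1: "i1 \<in> J"
      and d: "\<And>k' j. digit p k' (i1 $ j) =
      (if k' = k \<and> j = u then digit p k' (i $ j) - 1
       else if k' = k \<and> j = v then digit p k' (i $ j) + 1 else digit p k' (i $ j))" by auto
      have s: "digit_sum p l i1 = digit_sum p l i" for l by (rule digit_sum_change[OF u d])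
      have "p - 1 - digit p k (i1 $ v) < p - 1 - digit p k (i $ v)" using True u(1) by (simp add: d)
      moreover have "digit p (Suc k) (i1 $ v) < p - 1" using less(4) by (simp add: d)
      ultimately show ?thesis using less(1)[of i1, unfolded s] i1 less(3) by blast
    next
      case False
      then have pv: "digit p k (i $ v) = p - 1" using digit_less[of p k "i $ v"] p by linarith
      \<comment> \<open>Adding \<open>p ^ k\<close> on top of a digit \<open>p - 1\<close> amounts
        to clearing that digit and adding one at position \<open>Suc k\<close>, which is again
        carry-free.\<close>
      define b where "b = i $ v - (p - 1) * p ^ k"
      have b: "i $ v = b + (p - 1) * p ^ k"
        using digit_diff(1)[of "p - 1" p k "i $ v"] pv p by (simp add: b_def)
      have db: "digit p l b = digit p l (i $ v) - (if l = k then p - 1 else 0)" for l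
        unfolding b_def using pv p by (intro digit_diff) auto
      have sum: "i $ v + p ^ k = b + 1 * p ^ Suc k" using p by (cases p) (simp_all add: b)
      have "digit p (Suc k) b + 1 < p" using less(4) by (simp add: db)
      note add = digit_add[OF this] add_digit_less_power[OF this assms(2)]
      have bl: "b < p ^ m" using bound[OF less(2), of v] by (simp add: b)
      define i1 where "i1 = shift u v (p ^ k) i"
      have i1: "i1 \<in> J" unfolding i1_def
        using assms(2) u add(2)[OF bl] sum by (intro move[OF less(2)]) auto
      have dv: "digit p l (i1 $ v) =
          (if l = k then 0 else if l = Suc k then digit p l (i $ v) + 1 else digit p l (i $ v))" for l
        using add(1)[of l] sum pv u by (auto simp: i1_def shift_def db)
      have du: "digit p l (i1 $ u) = (if l = k then digit p l (i $ u) - 1 else digit p l (i $ u))" for l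
        using digit_diff(2)[of 1 p k "i $ u" l] p u by (auto simp: i1_def shift_def)
      have split2: "digit_sum p l x = digit p l (x $ v) + (digit p l (x $ u) + (\<Sum>j\<in>UNIV - {v} - {u}. digit p l (x $ j)))"
        for l and x :: "nat ^ 'n"
        unfolding split using u by (subst sum.remove[of _ u]) simp_all
      have rest: "(\<Sum>j\<in>UNIV - {v} - {u}. digit p l (i1 $ j)) = (\<Sum>j\<in>UNIV - {v} - {u}. digit p l (i $ j))" for l
        by (intro sum.cong) (auto simp: i1_def shift_def)
      show ?thesis using i1 u pv p
        by (intro bexI[of _ i1]) (auto simp: split2 rest dv du)
    qed
  qed
  then show thesis using that by blast
qed

text \<open>At the first position \<open>a\<close> where \<open>i'\<close> lies below
  \<open>i\<close>, the gap of \<open>p ^ Suc a\<close> forces a digit sum of at least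
  \<open>p\<close>. If no carry were possible from \<open>a\<close> on, every following position
  would be full, so the gap and the large digit sum would persist up to \<open>m - 1\<close>, where
  the entries agree.\<close>

lemma carry_position:
  fixes i i' :: "nat ^ 'n"
  assumes i: "\<And>j. i $ j < p ^ m" and i': "\<And>j. i' $ j < p ^ m" and sum: "exp_sum i = exp_sum i'"
    and m: "m > 0" and le: "\<And>k. k < m \<Longrightarrow> type_entry p i' k \<le> type_entry p i k"
    and ne: "\<exists>k<m. type_entry p i' k \<noteq> type_entry p i k"
  obtains k where "Suc k < m" "type_entry p i' k < type_entry p i k" "digit_sum p k i \<ge> p"
    "digit_sum p (Suc k) i < CARD('n) * (p - 1)"
proof -
  note found = that
  define D where "D k \<longleftrightarrow> k < m \<and> type_entry p i' k < type_entry p i k" for k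
  have last: "\<not> D (m - 1)" using type_entry_last[OF i m] type_entry_last[OF i' m] sum
    by (simp add: D_def)
  have "\<exists>k. D k" using ne le unfolding D_def by (metis le_neq_implies_less)
  then obtain a where a: "D a" and min: "\<And>k. k < a \<Longrightarrow> \<not> D k"
    by (metis exists_least_iff)
  have la: "digit_sum p a i \<ge> p"
  proof -
    have "type_entry p i' a + p ^ Suc a \<le> type_entry p i a"
      using type_entry_diff_dvd[OF i i' sum m, of a] a by (simp add: D_def)
    moreover have "type_entry p i a \<le> type_entry p i' a + digit_sum p a i * p ^ a"
    proof (cases a)
      case (Suc b)
      then have "type_entry p i b \<le> type_entry p i' b"
        using min[of b] a by (auto simp: D_def)
      then show ?thesis by (simp add: Suc type_entry_Suc)
    qed (simp add: type_entry_def)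
    ultimately have "p ^ Suc a \<le> digit_sum p a i * p ^ a" by linarith
    then show ?thesis using p by simp
  qed
  \<comment> \<open>Hence a full position has digit sum at least \<open>p\<close> and can itself be
    the source of the next carry.\<close>
  have np: "CARD('n) * (p - 1) \<ge> p" using la digit_sum_le[of p a i] p by simp
  show thesis
  proof (rule ccontr)
    assume nt: "\<not> thesis"
    have no: "digit_sum p (Suc k) i \<ge> CARD('n) * (p - 1)"
      if "Suc k < m" "D k" "digit_sum p k i \<ge> p" for k
      using found[of k] nt that unfolding D_def by (metis not_less)
    have "a \<le> k \<Longrightarrow> k < m \<longrightarrow> D k \<and> digit_sum p k i \<ge> p" for k
    proof (induction k rule: dec_induct)
      case base
      then show ?case using a la by simp
    next
      case (step k)
      show ?case
      proof
        assume km: "Suc k < m"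
        then have k: "D k" "digit_sum p k i \<ge> p" using step by auto
        have ge: "digit_sum p (Suc k) i \<ge> CARD('n) * (p - 1)" by (rule no[OF km k])
        then have "digit_sum p (Suc k) i' \<le> digit_sum p (Suc k) i"
          using digit_sum_le[of p "Suc k" i'] p by simp
        then have "digit_sum p (Suc k) i' * p ^ Suc k \<le> digit_sum p (Suc k) i * p ^ Suc k"
          by (rule mult_right_mono) simp
        then show "D (Suc k) \<and> digit_sum p (Suc k) i \<ge> p"
          using k km ge np unfolding D_def type_entry_Suc by linarith
      qed
    qed
    moreover have "a \<le> m - 1" using a by (auto simp: D_def)
    ultimately show False using last m by auto
  qed
qed

text \<open>Each carry lowers one entry and, by \<open>type_entry_diff_dvd\<close>, does not push it
  below the target, so the sum of the entries serves as induction measure. Once the types agree, so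
  do the digit sums, and \<open>same_digit_sums\<close> applies.\<close>

lemma type_le_closed:
  assumes "i \<in> J" "\<And>j. i' $ j < p ^ m" "exp_sum i = exp_sum i'" "m > 0"
    "\<And>k. k < m \<Longrightarrow> type_entry p i' k \<le> type_entry p i k"
  shows "i' \<in> J"
  using assms(1,3,5)
proof (induction "\<Sum>k<m. type_entry p i k" arbitrary: i rule: less_induct)
  case less
  note bi = bound[OF less(2)]
  show ?case
  proof (cases "\<exists>k<m. type_entry p i' k \<noteq> type_entry p i k")
    case True
    from carry_position[OF bi assms(2) less(3) assms(4) less(4) True]
    obtain k where k: "Suc k < m" "type_entry p i' k < type_entry p i k" "digit_sum p k i \<ge> p"
      "digit_sum p (Suc k) i < CARD('n) * (p - 1)" by blast
    from carry_step[OF less(2) k(1,3,4)] obtain i1 where i1: "i1 \<in> J"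
      and ds: "\<And>l. digit_sum p l i1 = (if l = k then digit_sum p k i - p
        else if l = Suc k then digit_sum p l i + 1 else digit_sum p l i)" by blast
    \<comment> \<open>The \<open>p\<close> units lost at \<open>k\<close> weigh as much as the one
      unit gained at \<open>Suc k\<close>, so only the entry at \<open>k\<close> changes.\<close>
    have t: "type_entry p i1 l + (if l = k then p ^ Suc k else 0) = type_entry p i l" for l
    proof -
      have lt: "type_entry p i1 l = type_entry p i l" if "l < k" for l
        unfolding type_entry_def using that by (intro sum.cong) (auto simp: ds)
      have "digit_sum p k i1 * p ^ k + p ^ Suc k = digit_sum p k i * p ^ k"
        using k(3) by (simp add: ds algebra_simps flip: distrib_right)
      then have eq: "type_entry p i1 k + p ^ Suc k = type_entry p i k"
        using lt[of "k - 1"] by (cases k) (simp_all add: type_entry_Suc type_entry_def)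
      have gt: "type_entry p i1 l = type_entry p i l" if "Suc k \<le> l" for l
        using that
      proof (induction l rule: dec_induct)
        case base
        then show ?case using eq by (simp add: type_entry_Suc ds algebra_simps)
      next
        case (step l)
        then show ?case by (simp add: type_entry_Suc ds)
      qed
      show ?thesis using lt[of l] eq gt[of l] by (cases l k rule: linorder_cases) auto
    qed
    have sum: "exp_sum i1 = exp_sum i"
    proof -
      have "m - 1 \<noteq> k" using k(1) by simp
      then show ?thesis
        using t[of "m - 1"] type_entry_last[OF bi assms(4)]
          type_entry_last[OF bound[OF i1] assms(4)] by simp
    qed
    show ?thesis
    proof (rule less(1)[OF _ i1])
      have tle: "type_entry p i1 l \<le> type_entry p i l" for l using t[of l] by linarith
      have tk: "type_entry p i1 k + p ^ Suc k = type_entry p i k" using t[of k] by simp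
      have "p ^ Suc k > 0" using p by simp
      then have "type_entry p i1 k < type_entry p i k" using tk by linarith
      then show "(\<Sum>k<m. type_entry p i1 k) < (\<Sum>k<m. type_entry p i k)"
        using tle k(1) by (intro sum_strict_mono_ex1) (auto intro!: bexI[of _ k])
      show "exp_sum i1 = exp_sum i'" using sum less(3) by simp
      have "type_entry p i' k + p ^ Suc k \<le> type_entry p i k"
        using type_entry_diff_dvd[OF bi assms(2) less(3) assms(4) _ k(2)] k(1) by simp
      then have "type_entry p i' k \<le> type_entry p i1 k" using tk by linarith
      then show "type_entry p i' l \<le> type_entry p i1 l" if "l < m" for l
        using t[of l] less(4)[OF that] by (cases "l = k") auto
    qed
  next
    case False
    have "digit_sum p l i = digit_sum p l i'" if "l < m" for l
    proof (cases l)
      case 0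
      then show ?thesis using False that by (auto simp: type_entry_def)
    next
      case (Suc k)
      then have "type_entry p i' l = type_entry p i l" "type_entry p i' k = type_entry p i k"
        using False that by auto
      then show ?thesis using p by (simp add: Suc type_entry_Suc)
    qed
    then show ?thesis by (rule same_digit_sums[OF less(2) assms(2)])
  qed
qed

end

section \<open>Coefficients of functions and the action on monomials\<close>

definition box :: "nat \<Rightarrow> (nat ^ 'n) set" where
  "box N = {i. \<forall>j. i $ j \<le> N}"

lemma finite_box: "finite (box N :: (nat ^ 'n) set)"
  unfolding box_def by (rule finite_exponents)

lemma Omega_eq: "Omega q r = {i \<in> box (q - 1). exp_sum i = r}"
  by (auto simp: Omega_def box_def)

lemma finite_Omega: "finite (Omega q r)"
  unfolding Omega_eq by (rule finite_subset[OF _ finite_box]) auto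

definition coef :: "('a::{field,finite} ^ 'n \<Rightarrow> 'a) \<Rightarrow> nat ^ 'n \<Rightarrow> 'a" where
  "coef f i = Poly_Mapping.lookup (reduced_poly f) i"

lemma keys_reduced_poly:
  fixes f :: "'a::{field,finite} ^ 'n \<Rightarrow> 'a"
  shows "Poly_Mapping.keys (reduced_poly f) \<subseteq> box (CARD('a) - 1)"
  using reduced_poly_props(1)[of f] by (auto simp: reduced_def box_def)

lemma coef_outside:
  fixes f :: "'a::{field,finite} ^ 'n \<Rightarrow> 'a"
  shows "i \<notin> box (CARD('a) - 1) \<Longrightarrow> coef f i = 0"
  using keys_reduced_poly[of f] by (auto simp: coef_def in_keys_iff)

lemma coef_sum:
  fixes f :: "'a::{field,finite} ^ 'n \<Rightarrow> 'a"
  shows "f x = (\<Sum>i\<in>box (CARD('a) - 1). coef f i * monom_fun i x)"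
  using poly_fun_superset[OF keys_reduced_poly[of f] finite_box, of x]
  by (simp add: reduced_poly_props(2) coef_def)

lemma coef_unique:
  fixes f :: "'a::{field,finite} ^ 'n \<Rightarrow> 'a"
  assumes "\<And>x. f x = (\<Sum>i\<in>box (CARD('a) - 1). c i * monom_fun i x)"
  shows "coef f i = (if i \<in> box (CARD('a) - 1) then c i else 0)"
proof -
  let ?B = "box (CARD('a) - 1) :: (nat ^ 'n) set"
  define P where "P = Abs_poly_mapping (\<lambda>i. if i \<in> ?B then c i else 0)"
  have lP: "Poly_Mapping.lookup P = (\<lambda>i. if i \<in> ?B then c i else 0)"
    unfolding P_def by (rule lookup_Abs_poly_mapping) (rule finite_subset[OF _ finite_box], auto)
  have k: "Poly_Mapping.keys P \<subseteq> ?B" by (auto simp: in_keys_iff lP split: if_splits)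
  have "poly_fun P x = f x" for x
    unfolding poly_fun_superset[OF k finite_box] assms by (intro sum.cong) (simp_all add: lP)
  moreover have "reduced P" using k by (auto simp: reduced_def box_def)
  ultimately have "reduced_poly f = P" by (intro reduced_poly_eqI) auto
  then show ?thesis by (simp add: coef_def lP)
qed

lemma coef_add:
  fixes f :: "'a::{field,finite} ^ 'n \<Rightarrow> 'a"
  shows "coef (\<lambda>x. f x + g x) i = coef f i + coef g i"
proof -
  have "coef (\<lambda>x. f x + g x) i = (if i \<in> box (CARD('a) - 1) then coef f i + coef g i else 0)"
    by (rule coef_unique) (simp add: distrib_right sum.distrib del: One_nat_def flip: coef_sum)
  then show ?thesis by (simp add: coef_outside)
qed

lemma coef_scale:
  fixes f :: "'a::{field,finite} ^ 'n \<Rightarrow> 'a"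
  shows "coef (\<lambda>x. c * f x) i = c * coef f i"
proof -
  have "coef (\<lambda>x. c * f x) i = (if i \<in> box (CARD('a) - 1) then c * coef f i else 0)"
    by (rule coef_unique) (simp add: mult.assoc del: One_nat_def flip: coef_sum sum_distrib_left)
  then show ?thesis by (simp add: coef_outside)
qed

lemma coef_diff: "coef (\<lambda>x. f x - g x) i = coef f i - coef g i"
  using coef_add[of f "\<lambda>x. (-1) * g x" i] coef_scale[of "-1" g i] by simp

lemma coef_monom_sum:
  fixes c :: "nat ^ 'n \<Rightarrow> 'a::{field,finite}"
  assumes "S \<subseteq> box (CARD('a) - 1)"
  shows "coef (\<lambda>x. \<Sum>s\<in>S. c s * monom_fun s x) i = (if i \<in> S then c i else 0)"
proof -
  have "(\<Sum>s\<in>S. c s * monom_fun s x)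
      = (\<Sum>s\<in>box (CARD('a) - 1). (if s \<in> S then c s else 0) * monom_fun s x)" for x
    using assms finite_box by (intro sum.mono_neutral_cong_left) auto
  then have "coef (\<lambda>x. \<Sum>s\<in>S. c s * monom_fun s x) i
      = (if i \<in> box (CARD('a) - 1) then if i \<in> S then c i else 0 else 0)"
    by (rule coef_unique)
  then show ?thesis using assms by auto
qed

lemma coef_monom:
  assumes "s \<in> box (CARD('a::{field,finite}) - 1)"
  shows "coef (monom_fun s :: 'a ^ 'n \<Rightarrow> 'a) i = (if i = s then 1 else 0)"
  using coef_monom_sum[of "{s}" "\<lambda>_. 1 :: 'a" i] assms by simp

lemma in_RM_coef:
  "f \<in> RM r \<longleftrightarrow> r \<ge> -1 \<and> (\<forall>i. coef f i \<noteq> 0 \<longrightarrow> int (exp_sum i) \<le> r)"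
  by (auto simp: in_RM_iff coef_def in_keys_iff)

definition leading :: "nat \<Rightarrow> ('a::{field,finite} ^ 'n \<Rightarrow> 'a) \<Rightarrow> 'a ^ 'n \<Rightarrow> 'a" where
  "leading r f x = (\<Sum>i\<in>Omega CARD('a) r. coef f i * monom_fun i x)"

lemma leading_diff:
  fixes f :: "'a::{field,finite} ^ 'n \<Rightarrow> 'a"
  assumes "f \<in> RM (int r)"
  shows "(\<lambda>x. f x - leading r f x) \<in> RM (int r - 1)"
proof -
  have "coef (leading r f) i = (if i \<in> Omega CARD('a) r then coef f i else 0)" for i
    unfolding leading_def[abs_def] by (rule coef_monom_sum) (auto simp: Omega_eq)
  then have c: "coef (\<lambda>x. f x - leading r f x) i = (if i \<in> Omega CARD('a) r then 0 else coef f i)" for i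
    by (simp add: coef_diff)
  have "int (exp_sum i) \<le> int r - 1" if "coef f i \<noteq> 0" "i \<notin> Omega CARD('a) r" for i
  proof -
    have "i \<in> box (CARD('a) - 1)" using that coef_outside by blast
    then show ?thesis using that assms by (force simp: in_RM_coef Omega_eq)
  qed
  then show ?thesis by (auto simp: in_RM_coef c)
qed

definition fsubspace :: "('x \<Rightarrow> 'a::semiring_0) set \<Rightarrow> bool" where
  "fsubspace W \<longleftrightarrow> (\<lambda>x. 0) \<in> W \<and> (\<forall>f\<in>W. \<forall>g\<in>W. (\<lambda>x. f x + g x) \<in> W) \<and>
     (\<forall>c. \<forall>f\<in>W. (\<lambda>x. c * f x) \<in> W)"

lemma fsubspace_zero: "fsubspace W \<Longrightarrow> (\<lambda>x. 0) \<in> W"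
  and fsubspace_add: "fsubspace W \<Longrightarrow> f \<in> W \<Longrightarrow> g \<in> W \<Longrightarrow> (\<lambda>x. f x + g x) \<in> W"
  and fsubspace_scale: "fsubspace W \<Longrightarrow> f \<in> W \<Longrightarrow> (\<lambda>x. c * f x) \<in> W"
  by (auto simp: fsubspace_def)

lemma fsubspace_diff:
  fixes W :: "('x \<Rightarrow> 'a::ring_1) set"
  shows "fsubspace W \<Longrightarrow> f \<in> W \<Longrightarrow> g \<in> W \<Longrightarrow> (\<lambda>x. f x - g x) \<in> W"
  using fsubspace_add[of W f "\<lambda>x. (-1) * g x"] fsubspace_scale[of W g "-1"] by simp

lemma fsubspace_sum:
  assumes "fsubspace W" "\<And>i. i \<in> S \<Longrightarrow> F i \<in> W"
  shows "(\<lambda>x. \<Sum>i\<in>S. F i x) \<in> W"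
  using assms(2)
proof (induction S rule: infinite_finite_induct)
  case (insert i S)
  then show ?case using fsubspace_add[OF assms(1), of "F i" "\<lambda>x. \<Sum>i\<in>S. F i x"] by simp
qed (use assms(1) in \<open>simp_all add: fsubspace_zero\<close>)

lemma fsubspace_lincomb:
  assumes "fsubspace W" "\<And>i. i \<in> S \<Longrightarrow> F i \<in> W"
  shows "(\<lambda>x. \<Sum>i\<in>S. c i * F i x) \<in> W"
  using assms(2) by (intro fsubspace_sum[OF assms(1)] fsubspace_scale[OF assms(1)])

lemma fsubspace_RM: "r \<ge> -1 \<Longrightarrow> fsubspace (RM r)"
  by (simp add: fsubspace_def RM_zero RM_add RM_scale)

section \<open>Degrees of monomial functions\<close>

lemma card_field_gt_1: "CARD('a::{field,finite}) > 1"
  using card_mono[of UNIV "{0, 1 :: 'a}"] by simp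

text \<open>\<open>finite_field_power_card_eq_same\<close> requires the class \<open>finite_field\<close>, which the sort
  \<open>{field,finite}\<close> does not entail.\<close>

lemma power_card:
  fixes x :: "'a::{field,finite}"
  shows "x ^ CARD('a) = x"
proof (cases "x = 0")
  case False
  have "(\<Prod>y\<in>UNIV - {0}. y) = (\<Prod>y\<in>UNIV - {0}. x * y)"
    by (rule prod.reindex_bij_witness[of _ "\<lambda>y. x * y" "\<lambda>y. y / x"]) (use False in auto)
  also have "\<dots> = x ^ (CARD('a) - 1) * (\<Prod>y\<in>UNIV - {0}. y)"
    by (simp add: prod.distrib card_Diff_singleton)
  finally have "x ^ (CARD('a) - 1) = 1" by simp
  then have "x ^ Suc (CARD('a) - 1) = x" by (simp only: power_Suc mult_1_right)
  moreover have "Suc (CARD('a) - 1) = CARD('a)" using card_field_gt_1[where ?'a = 'a] by simp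
  ultimately show ?thesis by (simp only:)
qed simp

text \<open>Since \<open>x ^ q = x\<close> on the field, an exponent above \<open>q - 1\<close> may
  drop by \<open>q - 1\<close>, which lowers the exponent sum. The new exponent vector may or may
  not lie in the box, so both bounds share one induction.\<close>

lemma monom_fun_RM_aux:
  "(monom_fun s :: 'a::{field,finite} ^ 'n \<Rightarrow> 'a) \<in>
     RM (if s \<in> box (CARD('a) - 1) then int (exp_sum s) else int (exp_sum s) - 1)"
proof (induction "exp_sum s" arbitrary: s rule: less_induct)
  case less
  let ?q = "CARD('a)"
  show ?case
  proof (cases "s \<in> box (?q - 1)")
    case True
    then show ?thesis by (simp add: in_RM_coef coef_monom)
  next
    case False
    then obtain j where j: "s $ j > ?q - 1" by (auto simp: box_def not_le)
    \<comment> \<open>The exponent of \<open>s'\<close> at \<open>j\<close> stays positive, so the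
      two powers also agree at zero.\<close>
    define s' where "s' = (\<chi> k. if k = j then s $ j - (?q - 1) else s $ k)"
    have q: "?q > 1" by (rule card_field_gt_1)
    have pow: "x ^ (s $ j) = x ^ (s $ j - (?q - 1))" for x :: 'a
    proof -
      have "x ^ (s $ j) = x ^ ?q * x ^ (s $ j - ?q)" using j by (simp flip: power_add)
      also have "\<dots> = x ^ Suc (s $ j - ?q)" by (simp add: power_card)
      also have "Suc (s $ j - ?q) = s $ j - (?q - 1)" using j q by linarith
      finally show ?thesis .
    qed
    have "monom_fun s x = monom_fun s' x" for x :: "'a ^ 'n"
      unfolding monom_fun_def by (intro prod.cong) (auto simp: s'_def pow)
    then have eq: "monom_fun s = (monom_fun s' :: 'a ^ 'n \<Rightarrow> 'a)" by auto
    have "exp_sum s = s $ j + (\<Sum>k\<in>UNIV - {j}. s $ k)"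
      unfolding exp_sum_def by (simp add: sum.remove)
    moreover have "exp_sum s' = s' $ j + (\<Sum>k\<in>UNIV - {j}. s $ k)"
      unfolding exp_sum_def by (simp add: sum.remove[of _ j] s'_def)
    ultimately have less': "exp_sum s' < exp_sum s" using j q by (simp add: s'_def)
    from less(1)[OF this] have "(monom_fun s :: 'a ^ 'n \<Rightarrow> 'a) \<in>
      RM (if s' \<in> box (?q - 1) then int (exp_sum s') else int (exp_sum s') - 1)" by (simp add: eq)
    moreover have "RM (if s' \<in> box (?q - 1) then int (exp_sum s') else int (exp_sum s') - 1)
        \<subseteq> (RM (int (exp_sum s) - 1) :: ('a ^ 'n \<Rightarrow> 'a) set)"
      using less' by (intro RM_mono) auto
    ultimately show ?thesis using False by auto
  qed
qed

lemma monom_fun_RM: "(monom_fun s :: 'a::{field,finite} ^ 'n \<Rightarrow> 'a) \<in> RM (int (exp_sum s))"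
  using monom_fun_RM_aux[of s, where ?'a = 'a] RM_mono[of "int (exp_sum s) - 1" "int (exp_sum s)"]
  by (auto split: if_splits)

text \<open>In degree \<open>r\<close> an overflowing monomial thus vanishes in \<open>H r\<close>.
  This disposes of the terms that leave the box under a substitution.\<close>

lemma monom_fun_RM_lower:
  "s \<notin> box (CARD('a) - 1) \<Longrightarrow>
    (monom_fun s :: 'a::{field,finite} ^ 'n \<Rightarrow> 'a) \<in> RM (int (exp_sum s) - 1)"
  using monom_fun_RM_aux[of s, where ?'a = 'a] by simp

lemma monom_fun_plus: "monom_fun (s + t) x = monom_fun s x * monom_fun t x"
  by (simp add: monom_fun_def power_add prod.distrib)

lemma monom_fun_zero: "monom_fun 0 x = 1"
  by (simp add: monom_fun_def)

section \<open>Spans of monomials and linear substitutions\<close>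

text \<open>A linear span in which exponents need not be reduced: products and Frobenius powers can
  be followed on exponents before \<open>x ^ q = x\<close> is applied.\<close>

inductive_set mspan :: "(nat ^ 'n) set \<Rightarrow> ('a::comm_semiring_1 ^ 'n \<Rightarrow> 'a) set" for S where
  zero: "(\<lambda>x. 0) \<in> mspan S"
| add: "f \<in> mspan S \<Longrightarrow> i \<in> S \<Longrightarrow> (\<lambda>x. c * monom_fun i x + f x) \<in> mspan S"

lemma mspan_minimal:
  assumes "fsubspace W" "\<And>i. i \<in> S \<Longrightarrow> monom_fun i \<in> W" "f \<in> mspan S"
  shows "f \<in> W"
  using assms(3)
proof induction
  case zero
  show ?case by (rule fsubspace_zero[OF assms(1)])
next
  case (add f i c)
  show ?case
    by (rule fsubspace_add[OF assms(1) fsubspace_scale[OF assms(1) assms(2)[OF add(2)]] add(3)])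
qed

lemma fsubspace_mspan:
  fixes S :: "(nat ^ 'n) set"
  shows "fsubspace (mspan S :: ('a::comm_semiring_1 ^ 'n \<Rightarrow> 'a) set)"
proof -
  have "(\<lambda>x. f x + g x) \<in> mspan S" if "f \<in> mspan S" "g \<in> mspan S" for f g :: "'a ^ 'n \<Rightarrow> 'a"
    using that by (induction f) (auto simp: add.assoc intro: mspan.add)
  moreover have "(\<lambda>x. c * f x) \<in> mspan S" if "f \<in> mspan S" for f :: "'a ^ 'n \<Rightarrow> 'a" and c
    using that by (induction f) (auto simp: distrib_left mult.assoc[symmetric] intro: mspan.intros)
  ultimately show ?thesis by (simp add: fsubspace_def mspan.zero)
qed

lemma monom_in_mspan: "s \<in> S \<Longrightarrow> monom_fun s \<in> mspan S"
  using mspan.add[OF mspan.zero, of s S 1] by simp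

lemma mspan_mult:
  fixes f g :: "'a::comm_semiring_1 ^ 'n \<Rightarrow> 'a"
  assumes "f \<in> mspan S" "g \<in> mspan T" "\<And>s t. s \<in> S \<Longrightarrow> t \<in> T \<Longrightarrow> s + t \<in> U"
  shows "(\<lambda>x. f x * g x) \<in> mspan U"
proof -
  have sub: "fsubspace {g. (\<lambda>x. h x * g x) \<in> mspan U}" for h :: "'a ^ 'n \<Rightarrow> 'a"
    using fsubspace_mspan[of U] unfolding fsubspace_def
    by (auto simp: distrib_left mult.left_commute)
  have mono: "(\<lambda>x. monom_fun s x * g x) \<in> mspan U" if "s \<in> S" for s
  proof -
    have "(\<lambda>x. monom_fun s x * monom_fun t x) \<in> (mspan U :: ('a ^ 'n \<Rightarrow> 'a) set)" if "t \<in> T" for t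
      using monom_in_mspan[OF assms(3)[OF \<open>s \<in> S\<close> that]] by (simp add: monom_fun_plus[abs_def])
    then show ?thesis using mspan_minimal[OF sub[of "monom_fun s"] _ assms(2)] by auto
  qed
  show ?thesis
    using mspan_minimal[OF sub[of g] _ assms(1)] mono by (simp add: mult.commute)
qed

text \<open>By \<open>type_entry_mod\<close>, the sums for \<open>k > 0\<close> are the entries of the type of \<open>s\<close>. Unlike the digit
  sums, they are subadditive in \<open>s\<close>.\<close>

definition trunc_exps :: "nat \<Rightarrow> nat \<Rightarrow> (nat \<Rightarrow> nat) \<Rightarrow> (nat ^ 'n) set" where
  "trunc_exps p N \<tau> = {s. exp_sum s = N \<and> (\<forall>k. (\<Sum>j\<in>UNIV. s $ j mod p ^ k) \<le> \<tau> k)}"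

lemma exp_sum_plus: "exp_sum (s + t) = exp_sum s + exp_sum t"
  by (simp add: exp_sum_def sum.distrib)

lemma mod_add_le: "(a + b) mod c \<le> a mod c + b mod (c :: nat)"
  by (metis mod_add_eq mod_less_eq_dividend)

lemma trunc_exps_plus:
  assumes "s \<in> trunc_exps p N \<tau>" "t \<in> trunc_exps p N' \<tau>'"
  shows "s + t \<in> trunc_exps p (N + N') (\<lambda>k. \<tau> k + \<tau>' k)"
proof -
  have "(\<Sum>j\<in>UNIV. (s + t) $ j mod p ^ k) \<le> \<tau> k + \<tau>' k" for k
  proof -
    have "(\<Sum>j\<in>UNIV. (s + t) $ j mod p ^ k) \<le> (\<Sum>j\<in>UNIV. s $ j mod p ^ k + t $ j mod p ^ k)"
      by (intro sum_mono) (simp add: mod_add_le)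
    also have "\<dots> \<le> \<tau> k + \<tau>' k"
      using assms by (auto simp: trunc_exps_def sum.distrib intro!: add_mono)
    finally show ?thesis .
  qed
  then show ?thesis using assms by (simp add: trunc_exps_def exp_sum_plus)
qed

lemma mspan_power:
  assumes "f \<in> mspan {s. exp_sum s = 1}"
  shows "(\<lambda>x. f x ^ c) \<in> mspan {s. exp_sum s = c}"
proof (induction c)
  case 0
  then show ?case using monom_in_mspan[of 0 "{s. exp_sum s = 0}"]
    by (simp add: monom_fun_zero[abs_def] exp_sum_def)
next
  case (Suc c)
  show ?case using mspan_mult[OF assms Suc, of "{s. exp_sum s = Suc c}"] by (simp add: exp_sum_plus)
qed

text \<open>In characteristic \<open>p\<close> the power map is additive, so no mixed terms arise
  and every exponent is multiplied by \<open>p\<close>.\<close>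

lemma mspan_frobenius:
  fixes f :: "'a::{field,finite} ^ 'n \<Rightarrow> 'a"
  assumes "f \<in> mspan S" "CHAR('a) = p" "prime p"
  shows "(\<lambda>x. f x ^ p) \<in> mspan {(\<chi> j. p * s $ j) | s. s \<in> S}"
  using assms(1)
proof induction
  case zero
  show ?case using prime_gt_0_nat[OF assms(3)] by (simp add: zero_power mspan.zero)
next
  case (add f i c)
  have "(c * monom_fun i x + f x) ^ p = c ^ p * monom_fun (\<chi> j. p * i $ j) x + f x ^ p" for x
  proof -
    have "(c * monom_fun i x + f x) ^ p = (c * monom_fun i x) ^ p + f x ^ p"
      using freshmans_dream[where ?'a = 'a] assms(2,3) by simp
    also have "monom_fun i x ^ p = monom_fun (\<chi> j. p * i $ j) x"
      by (simp add: monom_fun_def power_mult mult.commute[of p] flip: prod_power_distrib)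
    then have "(c * monom_fun i x) ^ p = c ^ p * monom_fun (\<chi> j. p * i $ j) x"
      by (simp add: power_mult_distrib)
    finally show ?thesis .
  qed
  then show ?case using add by (auto intro!: mspan.add)
qed

text \<open>Writing \<open>a = p b + c\<close> with \<open>c < p\<close>, the power \<open>f\<^sup>a\<close> is the Frobenius image of \<open>f\<^sup>b\<close> times \<open>f\<^sup>c\<close>.\<close>

lemma linear_form_power:
  fixes f :: "'a::{field,finite} ^ 'n \<Rightarrow> 'a"
  assumes f: "f \<in> mspan {s. exp_sum s = 1}" and p: "CHAR('a) = p" "prime p"
  shows "(\<lambda>x. f x ^ a) \<in> mspan (trunc_exps p a (\<lambda>k. a mod p ^ k))"
proof (induction a rule: less_induct)
  case (less a)
  show ?case
  proof (cases "a = 0")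
    case True
    then show ?thesis using monom_in_mspan[of 0 "trunc_exps p 0 (\<lambda>k. 0 mod p ^ k)"]
      by (simp add: monom_fun_zero[abs_def] trunc_exps_def exp_sum_def)
  next
    case False
    define b c where "b = a div p" and "c = a mod p"
    have p1: "p > 1" using p(2) by (rule prime_gt_1_nat)
    have a: "a = b * p + c" by (simp add: b_def c_def)
    have "b < a" using False p1 by (simp add: b_def)
    from mspan_frobenius[OF less[OF this] p]
    have 1: "(\<lambda>x. f x ^ (b * p)) \<in> mspan {(\<chi> j. p * s $ j) | s. s \<in> trunc_exps p b (\<lambda>k. b mod p ^ k)}"
      by (simp add: power_mult)
    have "(\<lambda>x. f x ^ (b * p) * f x ^ c) \<in> mspan (trunc_exps p a (\<lambda>k. a mod p ^ k))"
    proof (rule mspan_mult[OF 1 mspan_power[OF f]], clarsimp)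
      fix s t :: "nat ^ 'n"
      assume s: "s \<in> trunc_exps p b (\<lambda>k. b mod p ^ k)" and t: "c = exp_sum t"
      have "exp_sum (\<chi> j. p * s $ j) = b * p"
        using s by (simp add: exp_sum_def trunc_exps_def flip: sum_distrib_left)
      moreover have "(\<Sum>j\<in>UNIV. (p * s $ j + t $ j) mod p ^ k) \<le> a mod p ^ k" for k
      proof (cases k)
        case (Suc l)
        have "(\<Sum>j\<in>UNIV. (p * s $ j + t $ j) mod p ^ k)
            \<le> (\<Sum>j\<in>UNIV. p * (s $ j mod p ^ l) + t $ j)"
        proof (rule sum_mono)
          fix j
          have "(p * s $ j + t $ j) mod p ^ k \<le> (p * s $ j) mod p ^ k + t $ j mod p ^ k"
            by (rule mod_add_le)
          also have "\<dots> \<le> p * (s $ j mod p ^ l) + t $ j"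
            by (simp add: Suc)
          finally show "(p * s $ j + t $ j) mod p ^ k \<le> p * (s $ j mod p ^ l) + t $ j" .
        qed
        also have "\<dots> = p * (\<Sum>j\<in>UNIV. s $ j mod p ^ l) + c"
          by (simp add: sum.distrib sum_distrib_left t exp_sum_def)
        also have "\<dots> \<le> p * (b mod p ^ l) + c"
          using s by (simp add: trunc_exps_def)
        also have "\<dots> = a mod p ^ k"
          unfolding Suc power_Suc mod_mult2_eq by (simp add: b_def c_def)
        finally show ?thesis .
      qed simp
      ultimately show "(\<chi> j. p * s $ j) + t \<in> trunc_exps p a (\<lambda>k. a mod p ^ k)"
        using t by (simp add: trunc_exps_def exp_sum_plus a)
    qed
    then show ?thesis by (simp add: a power_add)
  qed
qed

lemma monom_fun_axis: "monom_fun (axis k 1) x = x $ k"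
proof -
  have "monom_fun (axis k 1) x = (\<Prod>j\<in>UNIV. if j = k then x $ k else 1)"
    unfolding monom_fun_def by (intro prod.cong) (auto simp: axis_def)
  then show ?thesis by simp
qed

lemma exp_sum_axis: "exp_sum (axis k c) = c"
  by (simp add: exp_sum_def axis_def)

text \<open>\<open>A\<close> substitutes linear forms for the variables. Their powers obey the
  bounds of \<open>linear_form_power\<close>, which add up over the variables by
  \<open>trunc_exps_plus\<close>.\<close>

lemma gl_act_monom:
  fixes A :: "'a::{field,finite} ^ 'n ^ 'n"
  assumes p: "CHAR('a) = p" "prime p"
  shows "gl_act A (monom_fun i) \<in> mspan (trunc_exps p (exp_sum i) (\<lambda>k. \<Sum>j\<in>UNIV. i $ j mod p ^ k))"
proof -
  have lin: "(\<lambda>x. (x v* A) $ j) \<in> mspan {s. exp_sum s = 1}" for j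
  proof -
    have "(\<lambda>x. \<Sum>k\<in>UNIV. A $ k $ j * monom_fun (axis k 1) x) \<in> mspan {s. exp_sum s = 1}"
      by (intro fsubspace_lincomb[OF fsubspace_mspan] monom_in_mspan) (simp add: exp_sum_axis)
    then show ?thesis by (simp add: monom_fun_axis vector_matrix_mult_def mult.commute flip: One_nat_def)
  qed
  have "(\<lambda>x. \<Prod>j\<in>S. (x v* A) $ j ^ (i $ j)) \<in>
    mspan (trunc_exps p (\<Sum>j\<in>S. i $ j) (\<lambda>k. \<Sum>j\<in>S. i $ j mod p ^ k))" for S
  proof (induction S rule: infinite_finite_induct)
    case (insert j S)
    show ?case
      using mspan_mult[OF linear_form_power[OF lin p] insert.IH trunc_exps_plus] insert.hyps by simp
  qed (use monom_in_mspan[of 0 "trunc_exps p 0 (\<lambda>k. 0)"] in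
      \<open>simp_all add: monom_fun_zero[abs_def] trunc_exps_def exp_sum_def\<close>)
  from this[of UNIV] show ?thesis by (simp add: gl_act_def monom_fun_def[abs_def] exp_sum_def)
qed

text \<open>Terms of the substituted monomial inside the box have the same degree and a type bounded
  by that of \<open>i\<close>; the others drop in degree by
  \<open>monom_fun_RM_lower\<close>.\<close>

lemma gl_act_monom_in:
  fixes A :: "'a::{field,finite} ^ 'n ^ 'n"
  assumes p: "CHAR('a) = p" "prime p" and W: "fsubspace W" "RM (int (exp_sum i) - 1) \<subseteq> W"
    and S: "\<And>s. \<lbrakk>s \<in> Omega CARD('a) (exp_sum i); \<And>k. type_entry p s k \<le> type_entry p i k\<rbrakk>
      \<Longrightarrow> monom_fun s \<in> W"
  shows "gl_act A (monom_fun i) \<in> W"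
proof (rule mspan_minimal[OF W(1) _ gl_act_monom[OF p]])
  fix s :: "nat ^ 'n" assume s: "s \<in> trunc_exps p (exp_sum i) (\<lambda>k. \<Sum>j\<in>UNIV. i $ j mod p ^ k)"
  show "(monom_fun s :: 'a ^ 'n \<Rightarrow> 'a) \<in> W"
  proof (cases "s \<in> box (CARD('a) - 1)")
    case True
    then show ?thesis using s
      by (intro S) (auto simp: Omega_eq trunc_exps_def type_entry_mod simp del: power_Suc)
  next
    case False
    then show ?thesis using monom_fun_RM_lower[OF False] W(2) s by (auto simp: trunc_exps_def)
  qed
qed

lemma gl_act_RM:
  fixes A :: "'a::{field,finite} ^ 'n ^ 'n"
  assumes p: "CHAR('a) = p" "prime p" and f: "f \<in> RM r"
  shows "gl_act A f \<in> RM r"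
proof -
  have r: "r \<ge> -1" using f by (simp add: in_RM_coef)
  have "(\<lambda>x. \<Sum>i\<in>box (CARD('a) - 1). coef f i * gl_act A (monom_fun i) x) \<in> RM r"
  proof (rule fsubspace_sum[OF fsubspace_RM[OF r]])
    fix i :: "nat ^ 'n"
    show "(\<lambda>x. coef f i * gl_act A (monom_fun i) x) \<in> RM r"
    proof (cases "coef f i = 0")
      case False
      then have i: "int (exp_sum i) \<le> r" using f by (simp add: in_RM_coef)
      have "gl_act A (monom_fun i) \<in> RM r"
      proof (rule gl_act_monom_in[OF p fsubspace_RM[OF r]])
        show "RM (int (exp_sum i) - 1) \<subseteq> RM r" using i by (intro RM_mono) simp
        fix s :: "nat ^ 'n" assume "s \<in> Omega CARD('a) (exp_sum i)"
        then show "monom_fun s \<in> RM r"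
          using monom_fun_RM[of s] RM_mono[OF i] by (auto simp: Omega_eq)
      qed
      then show ?thesis by (rule RM_scale)
    qed (simp add: RM_zero r)
  qed
  moreover have "gl_act A f = (\<lambda>x. \<Sum>i\<in>box (CARD('a) - 1). coef f i * gl_act A (monom_fun i) x)"
    unfolding gl_act_def by (rule ext) (rule coef_sum[of f])
  ultimately show ?thesis by simp
qed

section \<open>Stable subspaces are spanned by monomials\<close>

text \<open>The coefficients of the Lagrange polynomials form a one-sided inverse of the Vandermonde
  matrix \<open>(a ^ l)\<close>. For the other side, \<open>Q\<close> interpolates
  \<open>X ^ l\<close> at all field elements and equals it because of its low degree.\<close>

lemma interpolation_coefficients:
  "\<exists>c :: 'a \<Rightarrow> nat \<Rightarrow> 'a::{field,finite}. \<forall>k\<le>CARD('a) - 1. \<forall>l\<le>CARD('a) - 1.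
     (\<Sum>a\<in>UNIV. c a k * a ^ l) = (if k = l then 1 else 0)"
proof -
  let ?N = "CARD('a) - 1"
  have "\<exists>c. \<forall>a x :: 'a. (\<Sum>k\<le>?N. c a k * x ^ k) = (if x = a then 1 else 0)"
    by (intro choice allI indicator_univariate)
  then obtain c where c: "\<And>a x :: 'a. (\<Sum>k\<le>?N. c a k * x ^ k) = (if x = a then 1 else 0)"
    by blast
  have "(\<Sum>a\<in>UNIV. c a k * a ^ l) = (if k = l then 1 else 0)" if "k \<le> ?N" "l \<le> ?N" for k l
  proof -
    define Q where "Q = (\<Sum>a\<in>UNIV. smult (a ^ l) (\<Sum>k\<le>?N. Polynomial.monom (c a k) k))"
    have "Q = Polynomial.monom 1 l"
    proof (rule poly_eqI_degree[of UNIV])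
      show "poly Q x = poly (Polynomial.monom 1 l) x" for x
        unfolding Q_def by (simp add: poly_sum poly_monom c if_distrib del: One_nat_def cong: if_cong)
      have "degree Q \<le> ?N" unfolding Q_def
        by (intro degree_sum_le order.trans[OF degree_smult_le] order.trans[OF degree_monom_le]) auto
      then show "degree Q < CARD('a)" using card_field_gt_1[where ?'a = 'a] by simp
      show "degree (Polynomial.monom (1 :: 'a) l) < CARD('a)"
        using that card_field_gt_1[where ?'a = 'a] by (simp add: degree_monom_eq)
    qed
    then have "coeff Q k = (if k = l then 1 else 0)" by simp
    moreover have "coeff Q k = (\<Sum>a\<in>UNIV. a ^ l * c a k)"
      unfolding Q_def using that by (simp add: coeff_sum del: One_nat_def)
    ultimately show ?thesis by (simp add: mult.commute)
  qed
  then show ?thesis by blast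
qed

text \<open>A polynomial in \<open>a\<close> of degree at most \<open>q - 1\<close> is determined by
  its \<open>q\<close> values; the inverse Vandermonde matrix recovers each coefficient as a linear
  combination of them.\<close>

lemma coefficients_in_subspace:
  fixes W :: "('x \<Rightarrow> 'a::{field,finite}) set"
  assumes W: "fsubspace W" and F: "\<And>a. (\<lambda>x. \<Sum>k\<le>CARD('a) - 1. a ^ k * F k x) \<in> W"
    and k: "k \<le> CARD('a) - 1"
  shows "F k \<in> W"
proof -
  obtain c :: "'a \<Rightarrow> nat \<Rightarrow> 'a" where c: "\<And>k l. k \<le> CARD('a) - 1 \<Longrightarrow> l \<le> CARD('a) - 1 \<Longrightarrow>
     (\<Sum>a\<in>UNIV. c a k * a ^ l) = (if k = l then 1 else 0)"
    using interpolation_coefficients[where ?'a = 'a] by blast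
  have "(\<lambda>x. \<Sum>a\<in>UNIV. c a k * (\<Sum>l\<le>CARD('a) - 1. a ^ l * F l x)) \<in> W"
    by (rule fsubspace_lincomb[OF W F])
  moreover have "(\<Sum>a\<in>UNIV. c a k * (\<Sum>l\<le>CARD('a) - 1. a ^ l * F l x)) = F k x" for x
  proof -
    have "(\<Sum>a\<in>UNIV. c a k * (\<Sum>l\<le>CARD('a) - 1. a ^ l * F l x))
        = (\<Sum>l\<le>CARD('a) - 1. (\<Sum>a\<in>UNIV. c a k * a ^ l) * F l x)"
      unfolding sum_distrib_left sum_distrib_right mult.assoc by (rule sum.swap)
    also have "\<dots> = (\<Sum>l\<le>CARD('a) - 1. if l = k then F k x else 0)"
      using c[OF k] by (intro sum.cong) auto
    finally show ?thesis using k by simp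
  qed
  ultimately show ?thesis by simp
qed

text \<open>Compare the coefficients of \<open>X\<^sup>N\<close> in \<open>(1 + X)\<^sup>a = (1 + X\<^sup>N)\<^sup>h (1 + X)\<^sup>c\<close>, where \<open>N = p\<^sup>l\<close> and \<open>a = h N + c\<close>.\<close>

lemma of_nat_choose_prime_power:
  assumes p: "CHAR('a::field) = p" "prime p"
  shows "of_nat (a choose p ^ l) = (of_nat (a div p ^ l) :: 'a)"
proof -
  define N where "N = p ^ l"
  have N: "N > 0" using p(2) prime_gt_0_nat by (simp add: N_def)
  define h c where "h = a div N" and "c = a mod N"
  have a: "a = N * h + c" by (simp add: h_def c_def)
  have c: "c < N" using N by (simp add: c_def)
  let ?X = "[:0, 1:] :: 'a poly" and ?M = "Polynomial.monom (1 :: 'a) N"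
  have lin: "[:1, 1:] = 1 + ?X" by (simp add: one_pCons)
  have XM: "?X ^ N = ?M" by (simp add: monom_altdef)
  have "[:1, 1:] ^ N = 1 + ?M"
    unfolding lin using freshmans_dream'[where x = 1 and y = ?X and m = N and n = l] p by (simp add: N_def[symmetric] XM)
  then have pow: "[:1, 1:] ^ a = (1 + ?M) ^ h * [:1, 1:] ^ c"
    by (simp add: a power_add power_mult)
  \<comment> \<open>Only terms up to first order in \<open>X ^ N\<close> matter: the remainder is
    divisible by the square of \<open>X ^ N\<close> and does not reach the coefficient at
    \<open>N\<close>.\<close>
  have "\<exists>Q. (1 + ?M) ^ h = 1 + of_nat h * ?M + ?M * (?M * Q)"
  proof (induction h)
    case 0
    show ?case by (intro exI[of _ 0]) simp
  next
    case (Suc h)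
    then obtain Q where "(1 + ?M) ^ h = 1 + of_nat h * ?M + ?M * (?M * Q)" by blast
    then show ?case
      by (intro exI[of _ "of_nat h + Q + ?M * Q"]) (simp add: algebra_simps)
  qed
  then obtain Q where Q: "(1 + ?M) ^ h = 1 + of_nat h * ?M + ?M * (?M * Q)" by blast
  have "of_nat (a choose N) = coeff ([:1, 1 :: 'a:] ^ a) N"
  proof (cases "N \<le> a")
    case True
    then show ?thesis by (simp add: coeff_linear_poly_power)
  next
    case False
    moreover have "degree ([:1, 1 :: 'a:] ^ a) \<le> a" using degree_power_le[of "[:1, 1 :: 'a:]" a] by simp
    ultimately show ?thesis by (simp add: coeff_eq_0 binomial_eq_0)
  qed
  also have "[:1, 1:] ^ a = [:1, 1:] ^ c + ?M * (smult (of_nat h) ([:1, 1:] ^ c)) + ?M * (?M * (Q * [:1, 1:] ^ c))"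
    unfolding pow Q by (simp add: algebra_simps of_nat_poly)
  also have "coeff \<dots> N = of_nat h"
  proof -
    have "degree ([:1, 1 :: 'a:] ^ c) \<le> c" using degree_power_le[of "[:1, 1 :: 'a:]" c] by simp
    then have "coeff ([:1, 1 :: 'a:] ^ c) N = 0" using c by (intro coeff_eq_0) simp
    moreover have "coeff ([:1, 1 :: 'a:] ^ c) 0 = 1" by (simp add: coeff_0_power)
    ultimately show ?thesis using N by (simp add: coeff_monom_mult)
  qed
  finally show ?thesis by (simp add: N_def h_def)
qed

lemma of_nat_choose_digit:
  assumes "CHAR('a::field) = p" "prime p" "digit p l a > 0"
  shows "of_nat (a choose p ^ l) \<noteq> (0 :: 'a)"
  using assms by (simp add: of_nat_choose_prime_power of_nat_eq_0_iff_char_dvd digit_def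
      dvd_eq_mod_eq_0)

section \<open>Coordinate substitutions\<close>

text \<open>Allows substitutions to be given as maps with explicit inverses. The transpose appears
  because \<open>gl_act\<close> multiplies row vectors by \<open>A\<close> from the right.\<close>

lemma linear_bijection_matrix:
  fixes f g :: "'a::field ^ 'n \<Rightarrow> 'a ^ 'n"
  assumes f: "\<And>x y. f (x + y) = f x + f y" "\<And>c x. f (c *s x) = c *s f x"
    and g: "\<And>x y. g (x + y) = g x + g y" "\<And>c x. g (c *s x) = c *s g x"
    and fg: "\<And>x. f (g x) = x" and gf: "\<And>x. g (f x) = x"
  obtains A where "invertible A" "\<And>x. x v* A = f x"
proof -
  have lf: "Vector_Spaces.linear (*s) (*s) f" and lg: "Vector_Spaces.linear (*s) (*s) g"
    using f g vec.vector_space_axioms by (auto simp: Vector_Spaces.linear_iff)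
  have "matrix f ** matrix g = mat 1" "matrix g ** matrix f = mat 1"
    by (simp_all add: matrix_eq fg gf matrix_works[OF lf] matrix_works[OF lg]
        flip: matrix_vector_mul_assoc)
  then have "invertible (transpose (matrix f))"
    unfolding invertible_def by (metis matrix_transpose_mul transpose_mat)
  moreover have "x v* transpose (matrix f) = f x" for x
    using matrix_works[OF lf, of x] by (simp add: vector_transpose_matrix)
  ultimately show thesis using that by blast
qed

lemma prod_two:
  fixes f :: "'n::finite \<Rightarrow> 'a::comm_monoid_mult"
  assumes "u \<noteq> v"
  shows "prod f UNIV = f u * (f v * prod f (UNIV - {u} - {v}))"
  using assms by (subst prod.remove[of _ u], simp, simp, subst prod.remove[of _ v], simp_all)

lemma exp_sum_shift:
  assumes "u \<noteq> v" "k \<le> s $ u"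
  shows "exp_sum (shift u v k s) = exp_sum s"
proof -
  have *: "exp_sum t = t $ u + (t $ v + (\<Sum>j\<in>UNIV - {u} - {v}. t $ j))" for t :: "nat ^ 'a"
    unfolding exp_sum_def using assms(1)
    by (subst sum.remove[of _ u], simp, simp, subst sum.remove[of _ v], simp_all)
  have "(\<Sum>j\<in>UNIV - {u} - {v}. shift u v k s $ j) = (\<Sum>j\<in>UNIV - {u} - {v}. s $ j)"
    by (intro sum.cong) (auto simp: shift_def)
  then show ?thesis using assms by (simp add: * shift_def)
qed

text \<open>Binomial expansion in the coordinate \<open>u\<close>. The bound \<open>N\<close> can be
  shared by several monomials, whose sum then becomes one polynomial in \<open>a\<close>; for
  \<open>k > s $ u\<close> the binomial coefficient is zero, so the truncation in
  \<open>shift\<close> does no harm.\<close>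

lemma monom_fun_transvection:
  fixes x :: "'a::{field,finite} ^ 'n"
  assumes "u \<noteq> v" "s $ u \<le> N"
  shows "monom_fun s (\<chi> j. if j = u then x $ u + a * x $ v else x $ j)
    = (\<Sum>k\<le>N. a ^ k * (of_nat (s $ u choose k) * monom_fun (shift u v k s) x))"
proof -
  define R where "R = (\<Prod>j\<in>UNIV - {u} - {v}. (x $ j) ^ (s $ j))"
  have R: "(\<Prod>j\<in>UNIV - {u} - {v}. ((\<chi> j. if j = u then x $ u + a * x $ v else x $ j) $ j) ^ (s $ j)) = R"
    unfolding R_def by (intro prod.cong) auto
  have R': "(\<Prod>j\<in>UNIV - {u} - {v}. (x $ j) ^ (shift u v k s $ j)) = R" for k
    unfolding R_def by (intro prod.cong) (auto simp: shift_def)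
  have "monom_fun s (\<chi> j. if j = u then x $ u + a * x $ v else x $ j)
      = (a * x $ v + x $ u) ^ (s $ u) * ((x $ v) ^ (s $ v) * R)"
    unfolding monom_fun_def using assms(1) by (subst prod_two[OF assms(1)], subst R) (simp add: add.commute)
  also have "(a * x $ v + x $ u) ^ (s $ u)
      = (\<Sum>k\<le>N. of_nat (s $ u choose k) * (a * x $ v) ^ k * (x $ u) ^ (s $ u - k))"
    unfolding binomial_ring using assms(2)
    by (intro sum.mono_neutral_left) (auto simp: binomial_eq_0)
  also have "\<dots> * ((x $ v) ^ (s $ v) * R)
      = (\<Sum>k\<le>N. a ^ k * (of_nat (s $ u choose k) * monom_fun (shift u v k s) x))"
    unfolding sum_distrib_right
  proof (rule sum.cong[OF refl])
    fix k
    have "monom_fun (shift u v k s) x = (x $ u) ^ (s $ u - k) * ((x $ v) ^ (s $ v + k) * R)"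
      unfolding monom_fun_def using assms(1)
      by (subst prod_two[OF assms(1)], subst R') (simp add: shift_def)
    then show "of_nat (s $ u choose k) * (a * x $ v) ^ k * (x $ u) ^ (s $ u - k) * ((x $ v) ^ (s $ v) * R)
        = a ^ k * (of_nat (s $ u choose k) * monom_fun (shift u v k s) x)"
      by (simp add: power_mult_distrib power_add mult_ac)
  qed
  finally show ?thesis .
qed

lemma monom_fun_scale_coordinate:
  fixes x :: "'a::comm_semiring_1 ^ 'n"
  shows "monom_fun s (\<chi> j. if j = u then a * x $ u else x $ j) = a ^ (s $ u) * monom_fun s x"
  unfolding monom_fun_def
  by (subst (1 2) prod.remove[of _ u]) (simp_all add: power_mult_distrib mult.assoc)

lemma monom_fun_swap:
  fixes x :: "'a::comm_semiring_1 ^ 'n"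
  shows "monom_fun s (\<chi> j. x $ (if j = u then v else if j = v then u else j))
    = monom_fun (\<chi> j. s $ (if j = u then v else if j = v then u else j)) x"
  unfolding monom_fun_def
  by (rule prod.reindex_bij_witness[of _ "\<lambda>j. if j = u then v else if j = v then u else j"
        "\<lambda>j. if j = u then v else if j = v then u else j"]) (auto split: if_splits)

text \<open>Translation by one permutes the field, so comparing the sums of all elements shows that
  the cardinality is zero in it.\<close>

lemma CHAR_of_card:
  assumes prime: "prime p" and card: "CARD('a::{field,finite}) = p ^ m"
  shows "CHAR('a) = p"
proof -
  have "(\<Sum>x\<in>UNIV. x + 1) = (\<Sum>x\<in>UNIV. x :: 'a)"
    by (rule sum.reindex_bij_witness[of _ "\<lambda>x. x - 1" "\<lambda>x. x + 1"]) auto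
  then have "of_nat CARD('a) = (0 :: 'a)" by (simp add: sum.distrib)
  then have "CHAR('a) dvd p ^ m" by (simp only: of_nat_eq_0_iff_char_dvd card)
  moreover from this have "CHAR('a) > 0" using prime prime_gt_0_nat by (intro gr0I) auto
  then have "prime CHAR('a)" by (rule prime_CHAR_semidom)
  ultimately show ?thesis using prime by (metis prime_dvd_power primes_dvd_imp_eq)
qed

section \<open>Invariant subspaces between two consecutive degrees\<close>

text \<open>\<open>W\<close> stands for the preimage in \<open>RM (int r)\<close> of a submodule of
  \<open>H r\<close>, so that the arguments deal with functions instead of cosets.\<close>

locale gl_subspace =
  fixes p m r :: nat and W :: "('a::{field,finite} ^ 'n \<Rightarrow> 'a) set"
  assumes prime: "prime p" and m: "m \<ge> 1" and card: "CARD('a) = p ^ m"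
    and subspace: "fsubspace W" and lower: "RM (int r - 1) \<subseteq> W" and upper: "W \<subseteq> RM (int r)"
    and gl: "\<And>A f. invertible A \<Longrightarrow> f \<in> W \<Longrightarrow> gl_act A f \<in> W"
begin

lemma char: "CHAR('a) = p"
  by (rule CHAR_of_card[OF prime card])

lemma substitute:
  assumes "f \<in> W"
    and "\<And>x y. \<phi> (x + y) = \<phi> x + \<phi> y" "\<And>c x. \<phi> (c *s x) = c *s \<phi> x"
    and "\<And>x y. \<psi> (x + y) = \<psi> x + \<psi> y" "\<And>c x. \<psi> (c *s x) = c *s \<psi> x"
    and "\<And>x. \<phi> (\<psi> x) = x" "\<And>x. \<psi> (\<phi> x) = x"
  shows "(\<lambda>x. f (\<phi> x)) \<in> W"
proof -
  obtain A where A: "invertible A" "\<And>x. x v* A = \<phi> x"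
    using linear_bijection_matrix[of \<phi> \<psi>] assms(2-) by blast
  show ?thesis using gl[OF A(1) assms(1)] by (simp add: gl_act_def A(2))
qed

text \<open>Under the transvection with parameter \<open>a\<close> the function becomes a polynomial
  in \<open>a\<close> with the divided-power images as coefficients;
  \<open>coefficients_in_subspace\<close> extracts them.\<close>

lemma shift_closed:
  assumes f: "(\<lambda>x. \<Sum>s\<in>S. c s * monom_fun s x) \<in> W" and S: "S \<subseteq> Omega CARD('a) r"
    and uv: "u \<noteq> v" and k: "k \<le> CARD('a) - 1"
  shows "(\<lambda>x. \<Sum>s\<in>S. c s * (of_nat (s $ u choose k) * monom_fun (shift u v k s) x)) \<in> W"
proof (rule coefficients_in_subspace[OF subspace _ k])
  fix a :: 'a
  let ?\<phi> = "\<lambda>a (x :: 'a ^ 'n). \<chi> j. if j = u then x $ u + a * x $ v else x $ j"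
  have "(\<lambda>x. \<Sum>s\<in>S. c s * monom_fun s (?\<phi> a x)) \<in> W"
    by (rule substitute[OF f, of "?\<phi> a" "?\<phi> (- a)"]) (use uv in \<open>auto simp: vec_eq_iff algebra_simps\<close>)
  moreover have "(\<Sum>s\<in>S. c s * monom_fun s (?\<phi> a x)) = (\<Sum>k\<le>CARD('a) - 1.
      a ^ k * (\<Sum>s\<in>S. c s * (of_nat (s $ u choose k) * monom_fun (shift u v k s) x)))" for x
  proof -
    have "(\<Sum>s\<in>S. c s * monom_fun s (?\<phi> a x)) = (\<Sum>s\<in>S. \<Sum>k\<le>CARD('a) - 1.
        c s * (a ^ k * (of_nat (s $ u choose k) * monom_fun (shift u v k s) x)))"
      unfolding sum_distrib_left[symmetric]
    proof (rule sum.cong[OF refl])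
      fix s assume "s \<in> S"
      then have "s $ u \<le> CARD('a) - 1" using S by (auto simp: Omega_eq box_def)
      then have "monom_fun s (?\<phi> a x) = (\<Sum>k\<le>CARD('a) - 1.
        a ^ k * (of_nat (s $ u choose k) * monom_fun (shift u v k s) x))"
        by (rule monom_fun_transvection[OF uv])
      then show "c s * monom_fun s (?\<phi> a x) = c s * (\<Sum>k\<le>CARD('a) - 1.
        a ^ k * (of_nat (s $ u choose k) * monom_fun (shift u v k s) x))" by simp
    qed
    also have "\<dots> = (\<Sum>k\<le>CARD('a) - 1. \<Sum>s\<in>S.
        c s * (a ^ k * (of_nat (s $ u choose k) * monom_fun (shift u v k s) x)))"
      by (rule sum.swap)
    finally show ?thesis by (simp add: sum_distrib_left mult.left_commute)
  qed
  ultimately show "(\<lambda>x. \<Sum>k\<le>CARD('a) - 1. a ^ k *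
      (\<Sum>s\<in>S. c s * (of_nat (s $ u choose k) * monom_fun (shift u v k s) x))) \<in> W" by simp
qed

text \<open>The torus separates exponents modulo \<open>q - 1\<close>. Multiplying by \<open>a\<close> makes the identity
  \<open>a \<cdot> a\<^sup>s = a\<^sup>w\<close> valid for \<open>a = 0\<close> as well, so that interpolation over the whole field applies.\<close>

definition weight :: "nat \<Rightarrow> nat" where
  "weight e = (if e = CARD('a) - 1 then 1 else e + 1)"

text \<open>Scaling \<open>X_u\<close> by \<open>a\<close> and multiplying by \<open>a\<close> once
  more gives a polynomial in \<open>a\<close> whose coefficient at \<open>k\<close> collects the
  monomials of weight \<open>k\<close>.\<close>

lemma torus_closed:
  assumes f: "(\<lambda>x. \<Sum>s\<in>S. c s * monom_fun s x) \<in> W" and S: "S \<subseteq> Omega CARD('a) r"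
    and t: "t \<in> S"
  shows "(\<lambda>x. \<Sum>s | s \<in> S \<and> weight (s $ u) = weight (t $ u). c s * monom_fun s x) \<in> W"
proof -
  have fin: "finite S" using S finite_Omega finite_subset by blast
  have q: "CARD('a) > 1" by (rule card_field_gt_1)
  have wle: "weight (s $ u) \<le> CARD('a) - 1" if "s \<in> S" for s
  proof -
    have "s $ u \<le> CARD('a) - 1" using S that by (auto simp: Omega_eq box_def)
    then show ?thesis using q by (auto simp: weight_def)
  qed
  have wpow: "a * a ^ e = a ^ weight e" for a :: 'a and e
  proof (cases "e = CARD('a) - 1")
    case True
    then have "a * a ^ e = a ^ CARD('a)" using q by (simp flip: power_Suc)
    then show ?thesis using True by (simp add: weight_def power_card)
  qed (simp add: weight_def)
  define F where "F k x = (\<Sum>s\<in>S. if weight (s $ u) = k then c s * monom_fun s x else 0)"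
    for k and x :: "'a ^ 'n"
  have "F (weight (t $ u)) \<in> W"
  proof (rule coefficients_in_subspace[OF subspace _ wle[OF t]])
    fix a :: 'a
    have eq: "(\<Sum>k\<le>CARD('a) - 1. a ^ k * F k x) = a * (\<Sum>s\<in>S. c s * (a ^ (s $ u) * monom_fun s x))" for x
    proof -
      have "(\<Sum>k\<le>CARD('a) - 1. a ^ k * F k x) = (\<Sum>k\<le>CARD('a) - 1. \<Sum>s\<in>S.
          if weight (s $ u) = k then a ^ k * (c s * monom_fun s x) else 0)"
        unfolding F_def sum_distrib_left by (intro sum.cong) auto
      also have "\<dots> = (\<Sum>s\<in>S. \<Sum>k\<le>CARD('a) - 1.
          if weight (s $ u) = k then a ^ k * (c s * monom_fun s x) else 0)"
        by (rule sum.swap)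
      also have "\<dots> = (\<Sum>s\<in>S. a ^ weight (s $ u) * (c s * monom_fun s x))"
        by (intro sum.cong refl) (simp add: wle del: One_nat_def)
      finally show ?thesis by (simp add: sum_distrib_left wpow[symmetric] mult_ac)
    qed
    show "(\<lambda>x. \<Sum>k\<le>CARD('a) - 1. a ^ k * F k x) \<in> W"
    \<comment> \<open>Scaling by zero is not invertible, but the extra factor \<open>a\<close> makes
      the value the zero function.\<close>
    proof (cases "a = 0")
      case True
      then show ?thesis unfolding eq by (simp add: fsubspace_zero[OF subspace])
    next
      case False
      let ?\<phi> = "\<lambda>a (x :: 'a ^ 'n). \<chi> j. if j = u then a * x $ u else x $ j"
      have "(\<lambda>x. \<Sum>s\<in>S. c s * monom_fun s (?\<phi> a x)) \<in> W"
        by (rule substitute[OF f, of "?\<phi> a" "?\<phi> (inverse a)"])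
           (use False in \<open>auto simp: vec_eq_iff algebra_simps\<close>)
      then show ?thesis unfolding eq monom_fun_scale_coordinate
        by (rule fsubspace_scale[OF subspace])
    qed
  qed
  moreover have "F k = (\<lambda>x. \<Sum>s | s \<in> S \<and> weight (s $ u) = k. c s * monom_fun s x)" for k
    unfolding F_def using fin by (simp add: sum.inter_filter)
  ultimately show ?thesis by simp
qed

text \<open>The weights do not distinguish the exponents \<open>0\<close> and \<open>q - 1\<close>. Moving \<open>q - 1\<close> from \<open>u\<close> to \<open>v\<close>
  and swapping back does.\<close>

lemma extreme_closed:
  assumes f: "(\<lambda>x. \<Sum>s\<in>S. c s * monom_fun s x) \<in> W" and S: "S \<subseteq> Omega CARD('a) r"
    and uv: "u \<noteq> v"
  shows "(\<lambda>x. \<Sum>s | s \<in> S \<and> s $ u = CARD('a) - 1 \<and> s $ v = 0. c s * monom_fun s x) \<in> W"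
proof -
  define N where "N = CARD('a) - 1"
  define T where "T = {s \<in> S. s $ u = N \<and> s $ v = 0}"
  define g where "g s x = of_nat (s $ u choose N) * monom_fun (shift u v N s) x"
    for s and x :: "'a ^ 'n"
  define sw where "sw j = (if j = u then v else if j = v then u else j)" for j
  have fin: "finite S" using S finite_Omega finite_subset by blast
  have "T \<subseteq> S" by (auto simp: T_def)
  have "(\<lambda>x. \<Sum>s\<in>S. c s * g s x) \<in> W"
    unfolding g_def by (rule shift_closed[OF f S uv]) (simp add: N_def)
  \<comment> \<open>For \<open>s\<close> outside \<open>T\<close> either \<open>s $ u < N\<close>,
    and the binomial coefficient is zero, or the exponent at \<open>v\<close> rises above
    \<open>N\<close> and the monomial falls into \<open>RM (int r - 1)\<close>.\<close>
  moreover have "(\<lambda>x. \<Sum>s\<in>S - T. c s * g s x) \<in> W"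
  proof (rule fsubspace_lincomb[OF subspace])
    fix s assume s: "s \<in> S - T"
    then have b: "s $ u \<le> N" "exp_sum s = r" using S by (auto simp: Omega_eq box_def N_def)
    show "g s \<in> W"
    proof (cases "s $ u = N")
      case True
      then have "s $ v > 0" using s by (auto simp: T_def)
      then have "shift u v N s $ v > N" using uv by (simp add: shift_def)
      then have "shift u v N s \<notin> box (CARD('a) - 1)"
        unfolding box_def N_def[symmetric] by (auto simp: not_le)
      from monom_fun_RM_lower[OF this] exp_sum_shift[OF uv, of N s] b True lower
      have "monom_fun (shift u v N s) \<in> W" by auto
      then show ?thesis unfolding g_def by (rule fsubspace_scale[OF subspace])
    next
      case False
      then have "g s = (\<lambda>x. 0)" using b by (intro ext) (simp add: g_def binomial_eq_0)
      then show ?thesis by (simp add: fsubspace_zero[OF subspace])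
    qed
  qed
  ultimately have "(\<lambda>x. (\<Sum>s\<in>S. c s * g s x) - (\<Sum>s\<in>S - T. c s * g s x)) \<in> W"
    by (rule fsubspace_diff[OF subspace])
  moreover have "(\<Sum>s\<in>S. c s * g s x) = (\<Sum>s\<in>S - T. c s * g s x) + (\<Sum>s\<in>T. c s * g s x)" for x
    by (rule sum.subset_diff[OF \<open>T \<subseteq> S\<close> fin])
  ultimately have "(\<lambda>x. \<Sum>s\<in>T. c s * g s x) \<in> W" by simp
  then have "(\<lambda>x. \<Sum>s\<in>T. c s * g s (\<chi> j. x $ sw j)) \<in> W"
    by (rule substitute[of _ "\<lambda>x. \<chi> j. x $ sw j" "\<lambda>x. \<chi> j. x $ sw j"])
       (auto simp: vec_eq_iff sw_def)
  \<comment> \<open>On \<open>T\<close> the binomial coefficient is one and the exponents at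
    \<open>u\<close> and \<open>v\<close> have been interchanged, so swapping the variables restores
    \<open>s\<close>.\<close>
  moreover have "g s (\<chi> j. x $ sw j) = monom_fun s x" if "s \<in> T" for s x
  proof -
    have "(\<chi> j. shift u v N s $ sw j) = s"
      using that uv by (auto simp: vec_eq_iff sw_def shift_def T_def)
    then show ?thesis using that by (simp add: g_def T_def sw_def monom_fun_swap)
  qed
  ultimately show ?thesis unfolding T_def N_def by simp
qed

text \<open>If all weights agree, exponents can differ only as \<open>0\<close> and
  \<open>q - 1\<close>. Equal exponent sums then force a difference in each direction.\<close>

lemma separate_exponents:
  assumes "s \<in> Omega CARD('a) r" "t \<in> Omega CARD('a) r" "s \<noteq> t"
  obtains u where "weight (s $ u) \<noteq> weight (t $ u)"
    | u v where "u \<noteq> v" "s $ u = CARD('a) - 1" "s $ v = 0" "t $ u \<noteq> CARD('a) - 1"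
proof (cases "\<exists>u. weight (s $ u) \<noteq> weight (t $ u)")
  case False
  have "(\<lambda>j. s $ j) \<noteq> (\<lambda>j. t $ j)" using assms(3) by (auto simp: vec_eq_iff fun_eq_iff)
  moreover have "(\<Sum>j\<in>UNIV. s $ j) = (\<Sum>j\<in>UNIV. t $ j)"
    using assms(1,2) by (simp add: Omega_eq exp_sum_def)
  ultimately obtain u v where uv: "t $ u < s $ u" "s $ v < t $ v" using sum_eq_exchange by blast
  have "weight (s $ u) = weight (t $ u)" "weight (s $ v) = weight (t $ v)" using False by auto
  then have "s $ u = CARD('a) - 1" "s $ v = 0" "t $ u \<noteq> CARD('a) - 1" "u \<noteq> v"
    using uv by (auto simp: weight_def split: if_splits)
  then show thesis using that(2) by blast
qed (use that(1) in blast)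

text \<open>For any other monomial \<open>t\<close>, \<open>torus_closed\<close> or
  \<open>extreme_closed\<close> keeps \<open>s\<close> and discards \<open>t\<close>. Repeating this
  isolates \<open>s\<close>.\<close>

lemma support_monomials:
  assumes "S \<subseteq> Omega CARD('a) r" "\<And>s. s \<in> S \<Longrightarrow> c s \<noteq> 0"
    "(\<lambda>x. \<Sum>s\<in>S. c s * monom_fun s x) \<in> W" "s \<in> S"
  shows "monom_fun s \<in> W"
  using assms
proof (induction "card S" arbitrary: S rule: less_induct)
  case less
  note S = less(2) and W = less(4) and s = less(5)
  have fin: "finite S" using S finite_Omega finite_subset by blast
  have smaller: "monom_fun s \<in> W"
    if "(\<lambda>x. \<Sum>s | s \<in> S \<and> P s. c s * monom_fun s x) \<in> W" "P s" "t \<in> S" "\<not> P t" for P t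
  proof (rule less(1)[of "{s \<in> S. P s}"])
    show "card {s \<in> S. P s} < card S" using that fin by (intro psubset_card_mono) auto
  qed (use that less in auto)
  show ?case
  proof (cases "S = {s}")
    case True
    then have "(\<lambda>x. c s * monom_fun s x) \<in> W" using W by simp
    from fsubspace_scale[OF subspace this, of "inverse (c s)"] less(3)[OF s]
    show ?thesis by (simp flip: mult.assoc)
  next
    case False
    then obtain t where t: "t \<in> S" "s \<noteq> t" using s by blast
    have "s \<in> Omega CARD('a) r" "t \<in> Omega CARD('a) r" using S s t by auto
    from this t(2) show ?thesis
    proof (cases rule: separate_exponents)
      case (1 u)
      then show ?thesis
        using smaller[where P = "\<lambda>s'. weight (s' $ u) = weight (s $ u)", OF torus_closed[OF W S s]] t
        by auto
    next
      case (2 u v)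
      then show ?thesis
        using smaller[where P = "\<lambda>s'. s' $ u = CARD('a) - 1 \<and> s' $ v = 0",
            OF extreme_closed[OF W S 2(1)]] t by auto
    qed
  qed
qed

definition monomials :: "(nat ^ 'n) set" where
  "monomials = {i \<in> Omega CARD('a) r. monom_fun i \<in> W}"

text \<open>Modulo the lower space, which \<open>W\<close> contains, a function of degree at most
  \<open>r\<close> equals its \<open>leading\<close> part; so \<open>W\<close> is recovered from its
  monomials of degree \<open>r\<close>.\<close>

lemma W_eq: "W = {f \<in> RM (int r). \<forall>i\<in>Omega CARD('a) r. coef f i \<noteq> 0 \<longrightarrow> i \<in> monomials}"
proof (intro equalityI subsetI)
  fix f :: "'a ^ 'n \<Rightarrow> 'a" assume f: "f \<in> W"
  then have fr: "f \<in> RM (int r)" using upper by blast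
  let ?S = "{i \<in> Omega CARD('a) r. coef f i \<noteq> 0}"
  have "(\<lambda>x. f x - leading r f x) \<in> W" using leading_diff[OF fr] lower by blast
  from fsubspace_diff[OF subspace f this] have "leading r f \<in> W" by simp
  moreover have "leading r f = (\<lambda>x. \<Sum>i\<in>?S. coef f i * monom_fun i x)"
    unfolding leading_def[abs_def] using finite_Omega
    by (intro ext sum.mono_neutral_right) auto
  ultimately have *: "(\<lambda>x. \<Sum>i\<in>?S. coef f i * monom_fun i x) \<in> W" by simp
  have "monom_fun i \<in> W" if "i \<in> ?S" for i
    by (rule support_monomials[where c = "coef f", OF _ _ * that]) auto
  then show "f \<in> {f \<in> RM (int r). \<forall>i\<in>Omega CARD('a) r. coef f i \<noteq> 0 \<longrightarrow> i \<in> monomials}"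
    using fr by (auto simp: monomials_def)
next
  fix f :: "'a ^ 'n \<Rightarrow> 'a" assume f: "f \<in> {f \<in> RM (int r). \<forall>i\<in>Omega CARD('a) r. coef f i \<noteq> 0 \<longrightarrow> i \<in> monomials}"
  have "(\<lambda>x. coef f i * monom_fun i x) \<in> W" if "i \<in> Omega CARD('a) r" for i
    using f that fsubspace_zero[OF subspace] fsubspace_scale[OF subspace]
    by (cases "coef f i = 0") (auto simp: monomials_def)
  then have "leading r f \<in> W"
    unfolding leading_def[abs_def] by (rule fsubspace_sum[OF subspace])
  moreover have "(\<lambda>x. f x - leading r f x) \<in> W" using leading_diff[of f r] f lower by blast
  ultimately have "(\<lambda>x. leading r f x + (f x - leading r f x)) \<in> W"
    by (rule fsubspace_add[OF subspace])
  then show "f \<in> W" by simp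
qed

text \<open>Applied to one monomial with \<open>k = p ^ l\<close>, \<open>shift_closed\<close>
  yields the moved monomial times a binomial coefficient, which is invertible by
  \<open>of_nat_choose_digit\<close>.\<close>

lemma move_closed_monomials: "move_closed p m monomials"
proof
  show "p > 1" using prime by (rule prime_gt_1_nat)
next
  fix i j assume "i \<in> monomials"
  then have "i $ j \<le> p ^ m - 1" by (simp add: monomials_def Omega_eq box_def card)
  then show "i $ j < p ^ m" using card_field_gt_1[where ?'a = 'a] by (simp add: card)
next
  fix i u v l
  assume i: "i \<in> monomials" and uv: "u \<noteq> v" and l: "l < m" and d: "digit p l (i $ u) > 0"
    and b: "i $ v + p ^ l < p ^ m"
  have iO: "i \<in> Omega CARD('a) r" and iW: "monom_fun i \<in> W" using i by (auto simp: monomials_def)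
  have le: "p ^ l \<le> i $ u"
    using digit_diff(1)[of 1 p l "i $ u"] d prime prime_gt_0_nat by simp
  have "p ^ l \<le> CARD('a) - 1" using b by (simp add: card)
  from shift_closed[OF _ _ uv this, of "\<lambda>_. 1" "{i}"] iO iW
  have "(\<lambda>x. of_nat (i $ u choose p ^ l) * monom_fun (shift u v (p ^ l) i) x) \<in> W" by simp
  from fsubspace_scale[OF subspace this, of "inverse (of_nat (i $ u choose p ^ l))"]
    of_nat_choose_digit[OF char prime d]
  have "monom_fun (shift u v (p ^ l) i) \<in> W" by (simp flip: mult.assoc)
  moreover have "shift u v (p ^ l) i \<in> Omega CARD('a) r"
    using iO exp_sum_shift[OF uv le] b le
    by (auto simp: Omega_eq box_def shift_def card le_diff_conv intro: order.trans)
  ultimately show "shift u v (p ^ l) i \<in> monomials" by (simp add: monomials_def)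
qed

lemma monomials_lower:
  assumes "i \<in> monomials" "i' \<in> Omega CARD('a) r"
    "\<And>k. k < m \<Longrightarrow> type_entry p i' k \<le> type_entry p i k"
  shows "i' \<in> monomials"
proof (rule move_closed.type_le_closed[OF move_closed_monomials assms(1)])
  fix j
  have "i' $ j \<le> p ^ m - 1" using assms(2) by (simp add: Omega_eq box_def card)
  then show "i' $ j < p ^ m" using card_field_gt_1[where ?'a = 'a] by (simp add: card)
qed (use assms m in \<open>auto simp: monomials_def Omega_eq\<close>)

end

section \<open>Cosets and submodules\<close>

definition coset :: "nat \<Rightarrow> ('a::{field,finite} ^ 'n \<Rightarrow> 'a) \<Rightarrow> ('a ^ 'n \<Rightarrow> 'a) set" where
  "coset r f = RM (int r - 1) +>\<^bsub>RM_module (int r)\<^esub> f"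

lemma monom_class_coset: "monom_class r i = coset r (monom_fun i)"
  by (simp add: monom_class_def coset_def)

lemma in_coset_iff: "g \<in> coset r f \<longleftrightarrow> (\<lambda>x. g x - f x) \<in> RM (int r - 1)"
proof
  assume "g \<in> coset r f"
  then show "(\<lambda>x. g x - f x) \<in> RM (int r - 1)"
    by (auto simp: coset_def a_r_coset_def' RM_module_def fun_algebra_def)
next
  assume "(\<lambda>x. g x - f x) \<in> RM (int r - 1)"
  then show "g \<in> coset r f"
    by (auto simp: coset_def a_r_coset_def' RM_module_def fun_algebra_def
        intro!: bexI[of _ "\<lambda>x. g x - f x"])
qed

lemma fsubspace_lower: "fsubspace (RM (int r - 1))"
  by (rule fsubspace_RM) simp

lemma coset_self: "f \<in> coset r f"
  using fsubspace_zero[OF fsubspace_lower] by (simp add: in_coset_iff)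

lemma coset_eq_iff: "coset r f = coset r g \<longleftrightarrow> (\<lambda>x. f x - g x) \<in> RM (int r - 1)"
proof
  assume "coset r f = coset r g"
  then show "(\<lambda>x. f x - g x) \<in> RM (int r - 1)" using coset_self[of f r] by (simp add: in_coset_iff)
next
  assume *: "(\<lambda>x. f x - g x) \<in> RM (int r - 1)"
  show "coset r f = coset r g"
  proof (intro equalityI subsetI)
    fix h assume "h \<in> coset r f"
    then have "(\<lambda>x. (h x - f x) + (f x - g x)) \<in> RM (int r - 1)"
      unfolding in_coset_iff by (rule fsubspace_add[OF fsubspace_lower _ *])
    then show "h \<in> coset r g" by (simp add: in_coset_iff)
  next
    fix h assume "h \<in> coset r g"
    then have "(\<lambda>x. (h x - g x) - (f x - g x)) \<in> RM (int r - 1)"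
      unfolding in_coset_iff by (rule fsubspace_diff[OF fsubspace_lower _ *])
    then show "h \<in> coset r f" by (simp add: in_coset_iff)
  qed
qed

lemma carrier_H: "carrier (H r) = coset r ` RM (int r)"
  by (auto simp: H_def quotient_module_def A_RCOSETS_def' coset_def RM_module_def)

lemma zero_H: "\<zero>\<^bsub>H r\<^esub> = coset r (\<lambda>x. 0)"
proof -
  have "\<zero>\<^bsub>H r\<^esub> = RM (int r - 1)" by (simp add: H_def quotient_module_def)
  also have "\<dots> = coset r (\<lambda>x. 0)" by (auto simp: in_coset_iff)
  finally show ?thesis .
qed

lemma add_H:
  assumes "f \<in> RM (int r)" "g \<in> RM (int r)"
  shows "coset r f \<oplus>\<^bsub>H r\<^esub> coset r g = coset r (\<lambda>x. f x + g x)"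
  using module.quotient_add[OF module_RM_module submodule_RM, of "int r" "int r - 1" f g] assms
  by (simp add: H_def coset_def) (simp add: RM_module_def fun_algebra_def)

lemma smult_H:
  assumes "f \<in> RM (int r)"
  shows "c \<odot>\<^bsub>H r\<^esub> coset r f = coset r (\<lambda>x. c * f x)"
  using module.quotient_smult[OF module_RM_module submodule_RM, of "int r" "int r - 1" f c] assms
  by (simp add: H_def coset_def ring_of_type_algebra_def) (simp add: RM_module_def fun_algebra_def)

lemma finsum_H:
  fixes F :: "'i \<Rightarrow> 'a::{field,finite} ^ 'n \<Rightarrow> 'a"
  assumes "finite S" "\<And>i. i \<in> S \<Longrightarrow> F i \<in> RM (int r)"
  shows "(\<Oplus>\<^bsub>H r\<^esub> i\<in>S. c i \<odot>\<^bsub>H r\<^esub> coset r (F i)) = coset r (\<lambda>x. \<Sum>i\<in>S. c i * F i x)"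
proof -
  interpret M: module "ring_of_type_algebra :: 'a ring" "H r :: ('a, ('a ^ 'n \<Rightarrow> 'a) set) module"
    by (rule module_H)
  have sub: "fsubspace (RM (int r))" by (rule fsubspace_RM) simp
  show ?thesis using assms
  proof (induction S rule: finite_induct)
    case (insert i S)
    have coset_smult: "c i \<odot>\<^bsub>H r\<^esub> coset r (F i) = coset r (\<lambda>x. c i * F i x)" if "F i \<in> RM (int r)" for i
      using that by (rule smult_H)
    have closed: "c i \<odot>\<^bsub>H r\<^esub> coset r (F i) \<in> carrier (H r)" if "F i \<in> RM (int r)" for i
      using that by (simp add: coset_smult carrier_H RM_scale)
    have "(\<Oplus>\<^bsub>H r\<^esub> i\<in>insert i S. c i \<odot>\<^bsub>H r\<^esub> coset r (F i))
        = coset r (\<lambda>x. c i * F i x) \<oplus>\<^bsub>H r\<^esub> coset r (\<lambda>x. \<Sum>i\<in>S. c i * F i x)"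
      using insert closed by (subst M.finsum_insert) (auto simp: coset_smult)
    also have "\<dots> = coset r (\<lambda>x. \<Sum>i\<in>insert i S. c i * F i x)"
      using insert by (subst add_H) (auto intro!: RM_scale fsubspace_lincomb[OF sub])
    finally show ?case .
  qed (simp add: zero_H)
qed

text \<open>Invariance of the lower space under \<open>gl_act\<close> gives one inclusion; the
  inverse matrix supplies the other.\<close>

lemma gl_act_coset:
  fixes A :: "'a::{field,finite} ^ 'n ^ 'n"
  assumes p: "CHAR('a) = p" "prime p" and A: "invertible A"
  shows "gl_act A ` coset r f = coset r (gl_act A f)"
proof -
  obtain B where "A ** B = mat 1" using A by (auto simp: invertible_def)
  then have AB: "gl_act A (gl_act B h) = h" for h
    by (simp add: gl_act_def vector_matrix_mul_assoc)
  have "B ** A = mat 1" using \<open>A ** B = mat 1\<close> by (simp add: matrix_left_right_inverse)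
  then have BA: "gl_act B (gl_act A h) = h" for h
    by (simp add: gl_act_def vector_matrix_mul_assoc)
  have diff: "gl_act C (\<lambda>x. g x - h x) = (\<lambda>x. gl_act C g x - gl_act C h x)"
    for C :: "'a ^ 'n ^ 'n" and g h
    by (simp add: gl_act_def)
  have "gl_act C g \<in> coset r (gl_act C h)" if "g \<in> coset r h"
    for C :: "'a ^ 'n ^ 'n" and g h
    using gl_act_RM[OF p, of "\<lambda>x. g x - h x" "int r - 1" C] that by (simp add: in_coset_iff diff)
  from this[of _ f A] this[of _ "gl_act A f" B] show ?thesis
    by (auto simp: BA) (metis AB image_eqI)
qed

lemma submodule_cosets:
  fixes W :: "('a::{field,finite} ^ 'n \<Rightarrow> 'a) set"
  assumes W: "fsubspace W" "W \<subseteq> RM (int r)"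
  shows "submodule (coset r ` W) ring_of_type_algebra (H r)"
proof -
  interpret M: module "ring_of_type_algebra :: 'a ring" "H r :: ('a, ('a ^ 'n \<Rightarrow> 'a) set) module"
    by (rule module_H)
  have smult: "c \<odot>\<^bsub>H r\<^esub> C \<in> coset r ` W" if "C \<in> coset r ` W" for c C
    using that W smult_H fsubspace_scale[OF W(1)] by fastforce
  show ?thesis
  proof (rule M.submoduleI)
    show "coset r ` W \<subseteq> carrier (H r)" using W(2) by (auto simp: carrier_H)
    show "\<zero>\<^bsub>H r\<^esub> \<in> coset r ` W" using fsubspace_zero[OF W(1)] by (simp add: zero_H)
    show "C \<oplus>\<^bsub>H r\<^esub> D \<in> coset r ` W" if "C \<in> coset r ` W" "D \<in> coset r ` W" for C D
      using that W(2) fsubspace_add[OF W(1)] by (auto simp: add_H subset_iff)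
    show "c \<odot>\<^bsub>H r\<^esub> C \<in> coset r ` W" if "C \<in> coset r ` W" for c C using smult[OF that] .
    show "\<ominus>\<^bsub>H r\<^esub> C \<in> coset r ` W" if "C \<in> coset r ` W" for C
    proof -
      from that obtain f where f: "f \<in> W" "C = coset r f" by blast
      have g: "(\<lambda>x. (-1) * f x) \<in> W" by (rule fsubspace_scale[OF W(1) f(1)])
      have "coset r (\<lambda>x. (-1) * f x) \<oplus>\<^bsub>H r\<^esub> C = \<zero>\<^bsub>H r\<^esub>"
        using f g W(2) by (subst f(2), subst add_H) (auto simp: zero_H)
      then have "\<ominus>\<^bsub>H r\<^esub> C = coset r (\<lambda>x. (-1) * f x)"
        using f g W(2) by (intro M.minus_equality) (auto simp: carrier_H)
      then show ?thesis using g by blast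
    qed
  qed
qed

section \<open>The correspondence between ideals and submodules\<close>

text \<open>For \<open>S\<close> the exponents with type in \<open>I\<close> this is the full
  preimage of \<open>M(I)\<close>: only coefficients in degree \<open>r\<close> are constrained, so
  the lower space is contained.\<close>

definition supported :: "nat \<Rightarrow> (nat ^ 'n) set \<Rightarrow> ('a::{field,finite} ^ 'n \<Rightarrow> 'a) set" where
  "supported r S = {f \<in> RM (int r). \<forall>i\<in>Omega CARD('a) r. coef f i \<noteq> 0 \<longrightarrow> i \<in> S}"

lemma fsubspace_supported: "fsubspace (supported r S)"
  by (auto simp: fsubspace_def supported_def RM_zero RM_add RM_scale coef_add coef_scale)
     (use coef_scale[of 0] in auto)

lemma lower_subset_supported: "RM (int r - 1) \<subseteq> supported r S"
proof
  fix f :: "'a ^ 'b \<Rightarrow> 'a" assume f: "f \<in> RM (int r - 1)"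
  then have "f \<in> RM (int r)" using RM_mono[of "int r - 1" "int r"] by auto
  moreover have "coef f i = 0" if "i \<in> Omega CARD('a) r" for i
    using f that by (force simp: in_RM_coef Omega_eq)
  ultimately show "f \<in> supported r S" by (simp add: supported_def)
qed

lemma monom_fun_supported:
  assumes "i \<in> Omega CARD('a::{field,finite}) r"
  shows "(monom_fun i :: 'a ^ 'n \<Rightarrow> 'a) \<in> supported r S \<longleftrightarrow> i \<in> S"
  using assms monom_fun_RM[of i, where ?'a = 'a] coef_monom[of i, where ?'a = 'a]
  by (auto simp: supported_def Omega_eq)

text \<open>\<open>W\<close> is a union of cosets of the lower space, so membership can be tested on
  any representative.\<close>

lemma coset_in_cosets_iff:
  assumes "fsubspace W" "RM (int r - 1) \<subseteq> W"
  shows "coset r f \<in> coset r ` W \<longleftrightarrow> f \<in> W"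
proof
  assume "coset r f \<in> coset r ` W"
  then obtain g where g: "g \<in> W" "coset r f = coset r g" by blast
  then have "(\<lambda>x. f x - g x) \<in> W" using assms(2) by (auto simp: coset_eq_iff)
  from fsubspace_add[OF assms(1) g(1) this] show "f \<in> W" by simp
qed blast

lemma span_of_ideal_cosets:
  assumes card: "CARD('a::{field,finite}) = p ^ m"
  shows "span_of_ideal p m r I = coset r ` (supported r {i. type_of p m i \<in> I} :: ('a ^ 'n \<Rightarrow> 'a) set)"
proof -
  let ?S = "{i \<in> Omega (p ^ m) r. type_of p m i \<in> I} :: (nat ^ 'n) set"
  have fin: "finite ?S" by (rule finite_subset[OF _ finite_Omega]) auto
  have RM: "(monom_fun i :: 'a ^ 'n \<Rightarrow> 'a) \<in> RM (int r)" if "i \<in> ?S" for i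
    using that monom_fun_RM[of i, where ?'a = 'a] by (auto simp: Omega_eq)
  have "span_of_ideal p m r I
      = {coset r (\<lambda>x. \<Sum>i\<in>?S. c i * monom_fun i x) | c :: nat ^ 'n \<Rightarrow> 'a. True}"
    unfolding span_of_ideal_def monom_class_coset using finsum_H[OF fin RM] by simp
  also have "\<dots> = coset r ` supported r {i. type_of p m i \<in> I}"
  proof (intro equalityI subsetI)
    fix C assume "C \<in> {coset r (\<lambda>x. \<Sum>i\<in>?S. c i * monom_fun i x) | c :: nat ^ 'n \<Rightarrow> 'a. True}"
    then obtain c :: "nat ^ 'n \<Rightarrow> 'a" where C: "C = coset r (\<lambda>x. \<Sum>i\<in>?S. c i * monom_fun i x)"
      by blast
    have "(\<lambda>x. \<Sum>i\<in>?S. c i * monom_fun i x) \<in> supported r {i. type_of p m i \<in> I}"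
      by (intro fsubspace_lincomb[OF fsubspace_supported])
         (simp add: monom_fun_supported card)
    then show "C \<in> coset r ` supported r {i. type_of p m i \<in> I}" using C by blast
  next
    fix C :: "('a ^ 'n \<Rightarrow> 'a) set" assume "C \<in> coset r ` supported r {i. type_of p m i \<in> I}"
    then obtain f :: "'a ^ 'n \<Rightarrow> 'a"
      where f: "f \<in> supported r {i. type_of p m i \<in> I}" "C = coset r f" by blast
    have "coset r f = coset r (leading r f)"
      unfolding coset_eq_iff using f by (intro leading_diff) (simp add: supported_def)
    moreover have "leading r f = (\<lambda>x. \<Sum>i\<in>?S. coef f i * monom_fun i x)"
      unfolding leading_def[abs_def] card using f finite_Omega
      by (intro ext sum.mono_neutral_right) (auto simp: supported_def card)
    ultimately show "C \<in> {coset r (\<lambda>x. \<Sum>i\<in>?S. c i * monom_fun i x) | c :: nat ^ 'n \<Rightarrow> 'a. True}"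
      using f(2) by auto
  qed
  finally show ?thesis .
qed

lemma type_of_le_iff:
  "list_all2 (\<le>) (type_of p m i) (type_of p m i') \<longleftrightarrow> (\<forall>k<m. type_entry p i k \<le> type_entry p i' k)"
  by (simp add: type_of_entries list_all2_map_upt)

text \<open>The part of \<open>f\<close> below degree \<open>r\<close> stays below under
  substitution; in degree \<open>r\<close> types can only go down, and \<open>S\<close> is closed
  downwards.\<close>

lemma gl_act_supported:
  fixes A :: "'a::{field,finite} ^ 'n ^ 'n"
  assumes p: "CHAR('a) = p" "prime p" and f: "f \<in> supported r S"
    and S: "\<And>i s. \<lbrakk>i \<in> S; i \<in> Omega CARD('a) r; s \<in> Omega CARD('a) r;
      \<And>k. type_entry p s k \<le> type_entry p i k\<rbrakk> \<Longrightarrow> s \<in> S"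
  shows "gl_act A f \<in> supported r S"
proof -
  note sub = fsubspace_supported[of r S, where ?'a = 'a]
  have fr: "f \<in> RM (int r)" using f by (simp add: supported_def)
  have "gl_act A (\<lambda>x. f x - leading r f x) \<in> supported r S"
    using gl_act_RM[OF p leading_diff[OF fr], of A] lower_subset_supported by blast
  moreover have "(\<lambda>x. \<Sum>i\<in>Omega CARD('a) r. coef f i * gl_act A (monom_fun i) x) \<in> supported r S"
  proof (rule fsubspace_sum[OF sub])
    fix i :: "nat ^ 'n" assume i: "i \<in> Omega CARD('a) r"
    show "(\<lambda>x. coef f i * gl_act A (monom_fun i) x) \<in> supported r S"
    proof (cases "coef f i = 0")
      case True
      then show ?thesis by (simp add: fsubspace_zero[OF sub])
    next
      case False
      then have iS: "i \<in> S" using f i by (simp add: supported_def)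
      have r: "exp_sum i = r" using i by (simp add: Omega_eq)
      have "gl_act A (monom_fun i) \<in> supported r S"
        by (rule gl_act_monom_in[OF p sub])
           (use lower_subset_supported S[OF iS i] in \<open>auto simp: r monom_fun_supported\<close>)
      then show ?thesis by (rule fsubspace_scale[OF sub])
    qed
  qed
  ultimately have "(\<lambda>x. gl_act A (\<lambda>x. f x - leading r f x) x +
      (\<Sum>i\<in>Omega CARD('a) r. coef f i * gl_act A (monom_fun i) x)) \<in> supported r S"
    by (rule fsubspace_add[OF sub])
  then show ?thesis by (simp add: gl_act_def leading_def)
qed

lemma supported_in_GL_submodules:
  assumes "CHAR('a::{field,finite}) = p" "prime p"
    and "\<And>i s. \<lbrakk>i \<in> S; i \<in> Omega CARD('a) r; s \<in> Omega CARD('a) r;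
      \<And>k. type_entry p s k \<le> type_entry p i k\<rbrakk> \<Longrightarrow> s \<in> S"
  shows "coset r ` (supported r S :: ('a ^ 'n \<Rightarrow> 'a) set) \<in> GL_submodules r"
proof -
  have "submodule (coset r ` (supported r S :: ('a ^ 'n \<Rightarrow> 'a) set)) ring_of_type_algebra (H r)"
    by (rule submodule_cosets[OF fsubspace_supported]) (auto simp: supported_def)
  moreover have "gl_act A ` C \<in> coset r ` supported r S"
    if A: "invertible A" and C: "C \<in> coset r ` supported r S"
    for A :: "'a ^ 'n ^ 'n" and C
  proof -
    obtain f where f: "f \<in> supported r S" "C = coset r f" using C by blast
    have "gl_act A f \<in> supported r S" by (rule gl_act_supported[OF assms(1,2) f(1) assms(3)])
    then show ?thesis by (simp add: f(2) gl_act_coset[OF assms(1,2) A])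
  qed
  ultimately show ?thesis by (auto simp: GL_submodules_def)
qed

text \<open>\<open>W\<close> is the preimage of \<open>N\<close> under the quotient map; stability
  passes to it because \<open>A\<close> maps the coset of \<open>f\<close> to that of
  \<open>gl_act A f\<close>.\<close>

lemma GL_submodule_preimage:
  assumes p: "prime p" and m: "m \<ge> 1" and card: "CARD('a::{field,finite}) = p ^ m"
    and N: "N \<in> (GL_submodules r :: ('a ^ 'n \<Rightarrow> 'a) set set set)"
  obtains W where "gl_subspace p m r W" "N = coset r ` W"
proof -
  interpret M: module "ring_of_type_algebra :: 'a ring" "H r :: ('a, ('a ^ 'n \<Rightarrow> 'a) set) module"
    by (rule module_H)
  have sub: "submodule N ring_of_type_algebra (H r)"
    and gl: "\<And>(A :: 'a ^ 'n ^ 'n) C. invertible A \<Longrightarrow> C \<in> N \<Longrightarrow> gl_act A ` C \<in> N"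
    using N by (auto simp: GL_submodules_def)
  note E = M.submoduleE[OF sub]
  note chr = CHAR_of_card[OF p card]
  define W where "W = {f \<in> RM (int r). coset r f \<in> N}"
  have "\<zero>\<^bsub>H r\<^esub> \<in> N"
    using subgroup.one_closed[OF submodule.axioms(1)[OF sub]] by simp
  then have zero: "coset r f \<in> N" if "f \<in> RM (int r - 1)" for f
    using that coset_eq_iff[of r f "\<lambda>x. 0"] by (simp add: zero_H)
  have lower: "RM (int r - 1) \<subseteq> W"
    using zero RM_mono[of "int r - 1" "int r"] by (auto simp: W_def)
  have "gl_subspace p m r W"
  proof
    show "fsubspace W"
      unfolding fsubspace_def
    proof (intro conjI ballI allI)
      show "(\<lambda>x. 0) \<in> W" using lower fsubspace_zero[OF fsubspace_lower] by blast
      show "(\<lambda>x. f x + g x) \<in> W" if "f \<in> W" "g \<in> W" for f g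
        using that E(5)[of "coset r f" "coset r g"] by (simp add: W_def add_H RM_add)
      show "(\<lambda>x. c * f x) \<in> W" if "f \<in> W" for c f
        using that E(4)[of c "coset r f"]
        by (simp add: W_def smult_H RM_scale ring_of_type_algebra_def)
    qed
    show "gl_act A f \<in> W" if "invertible A" "f \<in> W" for A f
      using that gl[of A "coset r f"] gl_act_RM[OF chr p, of f "int r" A]
      by (simp add: W_def gl_act_coset[OF chr p])
  qed (use p m card lower in \<open>auto simp: W_def\<close>)
  moreover have "N = coset r ` W" using E(1) by (auto simp: W_def carrier_H)
  ultimately show thesis using that by blast
qed

theorem theorem3p9:
  fixes p m r :: nat
  assumes "prime p" and "m \<ge> 1" and "CARD('a::{field,finite}) = p ^ m"
    and "1 \<le> r" and "r \<le> CARD('n::finite) * (p ^ m - 1)"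
  shows "bij_betw
           (span_of_ideal p m r :: nat list set \<Rightarrow> ('a ^ 'n \<Rightarrow> 'a) set set)
           (poset_ideals (type_of p m ` (Omega (p ^ m) r :: (nat ^ 'n) set)))
           (GL_submodules r)"
proof -
  note span = span_of_ideal_cosets[OF assms(3)]
  let ?\<Omega> = "Omega (p ^ m) r :: (nat ^ 'n) set"
  let ?S = "\<lambda>I. {i :: nat ^ 'n. type_of p m i \<in> I}"
  have char: "CHAR('a) = p" by (rule CHAR_of_card[OF assms(1,3)])
  show ?thesis
  proof (rule bij_betwI')
    fix I I' assume I: "I \<in> poset_ideals (type_of p m ` ?\<Omega>)" "I' \<in> poset_ideals (type_of p m ` ?\<Omega>)"
    \<comment> \<open>Injectivity is tested on monomials: the class of a monomial of degree
      \<open>r\<close> lies in the span for \<open>J\<close> exactly when its type lies in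
      \<open>J\<close>.\<close>
    have sub: "J \<subseteq> J'"
      if J: "J \<subseteq> type_of p m ` ?\<Omega>"
        and eq: "span_of_ideal p m r J = (span_of_ideal p m r J' :: ('a ^ 'n \<Rightarrow> 'a) set set)" for J J'
    proof
      fix t assume "t \<in> J"
      then obtain i where i: "i \<in> ?\<Omega>" "t = type_of p m i" using J by blast
      then have "coset r (monom_fun i :: 'a ^ 'n \<Rightarrow> 'a) \<in> coset r ` supported r (?S J)"
        using \<open>t \<in> J\<close> by (intro imageI) (simp add: monom_fun_supported assms(3))
      then have "(monom_fun i :: 'a ^ 'n \<Rightarrow> 'a) \<in> supported r (?S J')"
        using eq unfolding span
        by (simp add: coset_in_cosets_iff[OF fsubspace_supported lower_subset_supported])
      then show "t \<in> J'" using i by (simp add: monom_fun_supported assms(3))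
    qed
    show "(span_of_ideal p m r I = (span_of_ideal p m r I' :: ('a ^ 'n \<Rightarrow> 'a) set set)) = (I = I')"
      using sub[of I I'] sub[of I' I] I by (auto simp: poset_ideals_def)
  next
    fix I assume I: "I \<in> poset_ideals (type_of p m ` ?\<Omega>)"
    show "span_of_ideal p m r I \<in> (GL_submodules r :: ('a ^ 'n \<Rightarrow> 'a) set set set)"
      unfolding span
    proof (rule supported_in_GL_submodules[OF char assms(1)])
      fix i s :: "nat ^ 'n"
      assume "i \<in> ?S I" "i \<in> Omega CARD('a) r" "s \<in> Omega CARD('a) r"
        "\<And>k. type_entry p s k \<le> type_entry p i k"
      then show "s \<in> ?S I"
        using I type_of_le_iff[of p m s i] by (auto simp: poset_ideals_def assms(3))
    qed
  next
    fix N :: "('a ^ 'n \<Rightarrow> 'a) set set" assume "N \<in> GL_submodules r"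
    then obtain W where W: "gl_subspace p m r W" and N: "N = coset r ` W"
      using GL_submodule_preimage[OF assms(1-3)] by blast
    interpret gl_subspace p m r W by (rule W)
    let ?I = "type_of p m ` monomials"
    have closed: "i' \<in> monomials"
      if "i \<in> monomials" "i' \<in> ?\<Omega>" "list_all2 (\<le>) (type_of p m i') (type_of p m i)" for i i'
      using monomials_lower[OF that(1), of i'] that(2,3) by (simp add: type_of_le_iff assms(3))
    have "?I \<in> poset_ideals (type_of p m ` ?\<Omega>)"
      using closed by (auto simp: poset_ideals_def monomials_def assms(3))
    \<comment> \<open>Equal types are comparable, so membership in \<open>monomials\<close> depends
      on the type alone, and no exponent with type in \<open>?I\<close> is missed.\<close>
    moreover have "i \<in> monomials" if "i \<in> ?\<Omega>" "type_of p m i \<in> ?I" for i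
    proof -
      from that(2) obtain i0 where "i0 \<in> monomials" "type_of p m i = type_of p m i0" by blast
      then show ?thesis using closed[OF _ that(1)] by (simp add: list_all2_refl)
    qed
    then have "supported r (?S ?I) = W"
      by (subst W_eq) (auto simp: supported_def assms(3))
    ultimately show "\<exists>I\<in>poset_ideals (type_of p m ` ?\<Omega>). N = span_of_ideal p m r I"
      unfolding span N by metis
  qed
qed

end
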